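(* Consider the Poisson sampling model described in the context. For any $C>0$, there exists an absolute constant $c>0$ such that for any $k\in[\sqrt n, n^C]$ and any threshold $y_0\in\mathbb{N}$, the modified Good--Turing estimator $\widehat p^{\rm MGT}$ with threshold $y_0$ satisfies $$\mathrm{Reg}(\widehat p^{\rm MGT})\ge \frac{c}{\sqrt{n\log n}}.$$
   Context: Poisson sampling model: for an unknown $p^\star\in\Delta_k$ (the probability simplex in $\mathbb{R}^k$), one observes independent counts $N_i\sim\mathrm{Poi}(np_i^\star)$, $i\in[k]$. Risk: $r_n(p^\star,\widehat p)=\mathbb{E}_{p^\star}D_{KL}(p^\star\|\widehat p)$. An estimator is permutation invariant (PI) if $\widehat p(\pi(N))=\pi(\widehat p(N))$ for all permutations $\pi$ of $[k]$, where $\pi(y)=(y_{\pi(1)},\dots,y_{\pi(k)})$; the PI oracle $\widehat p^{\rm PI}$ is the PI estimator (allowed to depend on $p^\star$) minimizing $r_n(p^\star,\cdot)$. Regret: $\mathrm{Reg}(\widehat p)=\sup_{p^\star\in\Delta_k}[r_n(p^\star,\widehat p)-r_n(p^\star,\widehat p^{\rm PI})]$. Profiles: $\Phi_y=\sum_{i=1}^k\mathbf{1}\{N_i=y\}$. Modified Good--Turing estimator with threshold $y_0$: $\widehat p^{\rm MGT}_i\propto \frac{N_i+1}{n}\cdot\frac{\Phi_{N_i+1}+1}{\Phi_{N_i}}$ if $N_i\le y_0$, and $\widehat p^{\rm MGT}_i\propto N_i/n$ otherwise, normalized to sum to one. *)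

theory Defs
  imports "HOL-Probability.Probability" "HOL-Combinatorics.Permutations"
begin

definition poi :: "real \<Rightarrow> nat pmf" where
  "poi r = (if r > 0 then poisson_pmf r else return_pmf 0)"

definition prob_simplex :: "nat \<Rightarrow> (nat \<Rightarrow> real) set" where
  "prob_simplex k = {p. (\<forall>i<k. 0 \<le> p i) \<and> (\<forall>i\<ge>k. p i = 0) \<and> (\<Sum>i<k. p i) = 1}"

definition counts :: "nat \<Rightarrow> (nat \<Rightarrow> nat) set" where
  "counts k = {N. \<forall>i\<ge>k. N i = 0}"

definition count_law :: "nat \<Rightarrow> nat \<Rightarrow> (nat \<Rightarrow> real) \<Rightarrow> (nat \<Rightarrow> nat) pmf" where
  "count_law n k p = Pi_pmf {..<k} 0 (\<lambda>i. poi (real n * p i))"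

definition KL :: "nat \<Rightarrow> (nat \<Rightarrow> real) \<Rightarrow> (nat \<Rightarrow> real) \<Rightarrow> ennreal" where
  "KL k p q = (if \<exists>i<k. p i > 0 \<and> q i \<le> 0 then \<infinity>
               else ennreal (\<Sum>i<k. if p i = 0 then 0 else p i * ln (p i / q i)))"

definition estimators :: "nat \<Rightarrow> ((nat \<Rightarrow> nat) \<Rightarrow> (nat \<Rightarrow> real)) set" where
  "estimators k = {e. \<forall>N\<in>counts k. e N \<in> prob_simplex k}"

definition risk :: "nat \<Rightarrow> nat \<Rightarrow> (nat \<Rightarrow> real) \<Rightarrow> ((nat \<Rightarrow> nat) \<Rightarrow> (nat \<Rightarrow> real)) \<Rightarrow> ennreal" where
  "risk n k p e = (\<integral>\<^sup>+ N. KL k p (e N) \<partial>measure_pmf (count_law n k p))"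

definition PI_estimators :: "nat \<Rightarrow> ((nat \<Rightarrow> nat) \<Rightarrow> (nat \<Rightarrow> real)) set" where
  "PI_estimators k = {e \<in> estimators k.
     \<forall>\<pi> N. \<pi> permutes {..<k} \<longrightarrow> N \<in> counts k \<longrightarrow> e (\<lambda>i. N (\<pi> i)) = (\<lambda>i. e N (\<pi> i))}"

definition oracle_risk :: "nat \<Rightarrow> nat \<Rightarrow> (nat \<Rightarrow> real) \<Rightarrow> ennreal" where
  "oracle_risk n k p = (INF e\<in>PI_estimators k. risk n k p e)"

definition regret :: "nat \<Rightarrow> nat \<Rightarrow> ((nat \<Rightarrow> nat) \<Rightarrow> (nat \<Rightarrow> real)) \<Rightarrow> ereal" where
  "regret n k e = (SUP p\<in>prob_simplex k. enn2ereal (risk n k p e) - enn2ereal (oracle_risk n k p))"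

definition profile :: "nat \<Rightarrow> (nat \<Rightarrow> nat) \<Rightarrow> nat \<Rightarrow> nat" where
  "profile k N y = card {i. i < k \<and> N i = y}"

definition mgt_weight :: "nat \<Rightarrow> nat \<Rightarrow> nat \<Rightarrow> (nat \<Rightarrow> nat) \<Rightarrow> nat \<Rightarrow> real" where
  "mgt_weight n k y0 N i =
     (if N i \<le> y0 then (real (N i) + 1) / real n * ((real (profile k N (N i + 1)) + 1) / real (profile k N (N i)))
      else real (N i) / real n)"

definition MGT :: "nat \<Rightarrow> nat \<Rightarrow> nat \<Rightarrow> (nat \<Rightarrow> nat) \<Rightarrow> (nat \<Rightarrow> real)" where
  "MGT n k y0 N = (\<lambda>i. if i < k then mgt_weight n k y0 N i / (\<Sum>j<k. mgt_weight n k y0 N j) else 0)"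

end

theory Submission
  imports Defs "HOL-Real_Asymp.Real_Asymp"
begin

text \<open>The bad distributions are uniform on the first \<open>m\<close> symbols, so that the counts there are iid Poisson
  with mean \<open>r = n / m\<close>. The permutation-invariant oracle only has to tell zero counts from
  positive ones, and its risk is negligible for \<open>r \<ge> sqrt n\<close>. The Kullback--Leibler risk of
  normalized weights \<open>w\<close> dominates, by concavity of the logarithm, the average over pairs \<open>i, j\<close> of
  the squared relative discrepancy of \<open>w i\<close> and \<open>w j\<close>; hence it suffices to bound the
  expected discrepancy of a fixed pair from below.

  If \<open>y0 < 4 sqrt n\<close>, take \<open>m \<approx> sqrt n / 16\<close>: typical counts exceed \<open>y0\<close>, the weights are empirical
  frequencies, and their relative fluctuations have variance of order \<open>1 / r\<close>.
  If \<open>y0 \<ge> 4 sqrt n\<close>, take \<open>m \<approx> sqrt n\<close> and a level \<open>y\<close> in the upper tail where the Poisson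
  mass is of order \<open>1 / m\<close>. With probability of order \<open>1 / m\<close> the count of \<open>i\<close> is \<open>y\<close> and exactly one other
  symbol has a count in \<open>{y, y + 2}\<close>; these two alternatives are comparably likely and change the
  Good--Turing weight of \<open>i\<close> by a factor of two, which is a discrepancy of constant order.
  For the finitely many remaining pairs \<open>(n, k)\<close> a single configuration of counts suffices.\<close>

section \<open>Reduction to pairs of symbols\<close>

text \<open>A lower bound for the logarithm of the ratio of arithmetic to geometric mean. It depends
  only on \<open>a / b\<close>, so the normalization of the weights drops out.\<close>

definition gap :: "real \<Rightarrow> real \<Rightarrow> real" where
  "gap a b = ((a - b) / (a + b))\<^sup>2 / 2"

lemma gap_nonneg: "0 \<le> gap a b"
  by (simp add: gap_def)

text \<open>The difference on the right is \<open>- ln x / 2\<close> for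
  \<open>x = 4 * a * b / (a + b)\<^sup>2\<close>, and \<open>x = 1 - 2 * gap a b\<close>; the claim
  is then \<open>ln x \<le> x - 1\<close>.\<close>

lemma gap_le_ln:
  assumes "a > 0" "b > 0"
  shows "gap a b \<le> ln ((a + b) / 2) - (ln a + ln b) / 2"
proof -
  define x where "x = 4 * a * b / (a + b)\<^sup>2"
  have x: "x > 0" using assms by (simp add: x_def)
  have "ln x = ln 4 + ln a + ln b - 2 * ln (a + b)"
    using assms by (simp add: x_def ln_div ln_mult ln_realpow)
  also have "ln 4 = 2 * ln (2::real)"
    using ln_realpow[of 2 2] by simp
  finally have lnx: "ln x = 2 * ln 2 + ln a + ln b - 2 * ln (a + b)" .
  define G where "G = ln ((a + b) / 2) - (ln a + ln b) / 2"
  have "ln x = - 2 * G"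
    using assms lnx by (simp add: G_def ln_div field_simps)
  moreover have "ln x \<le> x - 1" using x by (rule ln_le_minus_one)
  moreover have "x - 1 = - 2 * gap a b"
  proof -
    have "x + 2 * gap a b = (4 * a * b + (a - b)\<^sup>2) / (a + b)\<^sup>2"
      by (simp add: x_def gap_def power_divide add_divide_distrib)
    also have "4 * a * b + (a - b)\<^sup>2 = (a + b)\<^sup>2"
      by (simp add: power2_eq_square algebra_simps)
    finally show ?thesis using assms by simp
  qed
  ultimately have "gap a b \<le> G" by linarith
  then show ?thesis by (simp add: G_def)
qed

text \<open>The tangent of \<open>ln\<close> at the mean weight \<open>a\<close> bounds
  \<open>ln ((w i + w j) / 2)\<close>. Averaged over all pairs, its linear part cancels, and the
  logarithm of the mean minus the mean logarithm remains. The normalizer \<open>S\<close> may exceed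
  the sum because symbols outside the support also carry weight, which only raises the
  divergence.\<close>

lemma mean_gap_le_KL:
  fixes w :: "nat \<Rightarrow> real"
  assumes m: "m > 0" and w: "\<And>i. i < m \<Longrightarrow> w i > 0" and S: "(\<Sum>i<m. w i) \<le> S"
  shows "(\<Sum>i<m. \<Sum>j<m. gap (w i) (w j)) / (real m)\<^sup>2
           \<le> (\<Sum>i<m. (1 / real m) * ln ((1 / real m) / (w i / S)))"
proof -
  define W where "W = (\<Sum>i<m. w i)"
  define a where "a = W / real m"
  have W: "W > 0" unfolding W_def using m w by (intro sum_pos) auto
  have Spos: "S > 0" using W S unfolding W_def by linarith
  have a: "a > 0" using W m by (simp add: a_def)
  define L where "L = (\<Sum>i<m. ln (w i))"
  have tangent: "gap (w i) (w j) \<le> ln a + ((w i + w j) / (2 * a) - 1) - (ln (w i) + ln (w j)) / 2"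
    if "i < m" "j < m" for i j
  proof -
    have p: "w i > 0" "w j > 0" using w that by auto
    have "ln (((w i + w j) / 2) / a) \<le> ((w i + w j) / 2) / a - 1"
      using p a by (intro ln_le_minus_one) simp
    moreover have "ln (((w i + w j) / 2) / a) = ln ((w i + w j) / 2) - ln a"
      using p a by (intro ln_divide_pos) auto
    moreover have "(w i + w j) / 2 / a = (w i + w j) / (2 * a)" by simp
    ultimately show ?thesis using gap_le_ln[OF p] by linarith
  qed
  have "(\<Sum>i<m. \<Sum>j<m. gap (w i) (w j))
      \<le> (\<Sum>i<m. \<Sum>j<m. ln a + ((w i + w j) / (2 * a) - 1) - (ln (w i) + ln (w j)) / 2)"
    using tangent by (intro sum_mono) auto
  also have "\<dots> = (\<Sum>i<m. \<Sum>j<m. (ln a - 1) + w i / (2 * a) + w j / (2 * a) - ln (w i) / 2 - ln (w j) / 2)"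
    by (intro sum.cong refl) (simp add: add_divide_distrib)
  also have "\<dots> = real m * (real m * (ln a - 1)) + 2 * (real m * (W / (2 * a))) - 2 * (real m * (L / 2))"
    by (simp add: sum.distrib sum_subtractf flip: sum_divide_distrib sum_distrib_left W_def L_def)
      (simp add: W_def L_def field_simps flip: sum_divide_distrib sum_distrib_left)
  also have "\<dots> = (real m)\<^sup>2 * (ln a - L / real m)"
    using m a W by (simp add: a_def field_simps power2_eq_square)
  finally have 1: "(\<Sum>i<m. \<Sum>j<m. gap (w i) (w j)) / (real m)\<^sup>2 \<le> ln a - L / real m"
    using m by (simp add: field_simps)
  have "(\<Sum>i<m. (1 / real m) * ln ((1 / real m) / (w i / S)))
      = (\<Sum>i<m. (1 / real m) * (ln S - ln (real m) - ln (w i)))"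
  proof (intro sum.cong refl)
    fix i assume "i \<in> {..<m}"
    then have "w i > 0" using w by simp
    then show "(1 / real m) * ln ((1 / real m) / (w i / S)) = (1 / real m) * (ln S - ln (real m) - ln (w i))"
      using m Spos by (simp add: ln_div ln_mult)
  qed
  also have "\<dots> = ln S - ln (real m) - L / real m"
    using m by (simp add: L_def sum_subtractf sum.distrib field_simps flip: sum_distrib_left sum_divide_distrib)
  also have "\<dots> \<ge> ln a - L / real m"
    using W S m by (simp add: a_def ln_div W_def)
  finally show ?thesis using 1 by linarith
qed

section \<open>Risk under uniform distributions\<close>

definition unif :: "nat \<Rightarrow> nat \<Rightarrow> real" where
  "unif m i = (if i < m then 1 / real m else 0)"

lemma unif_in_prob_simplex:
  assumes "0 < m" "m \<le> k"
  shows "unif m \<in> prob_simplex k"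
proof -
  have "(\<Sum>i<k. unif m i) = (\<Sum>i<m. unif m i)"
    using assms by (intro sum.mono_neutral_right) (auto simp: unif_def)
  then show ?thesis using assms by (auto simp: prob_simplex_def unif_def)
qed

lemma KL_unif:
  assumes "0 < m" "m \<le> k" "\<And>i. i < m \<Longrightarrow> q i > 0"
  shows "KL k (unif m) q = ennreal (\<Sum>i<m. (1 / real m) * ln ((1 / real m) / q i))"
proof -
  have "\<not> (\<exists>i<k. unif m i > 0 \<and> q i \<le> 0)"
    using assms(3) by (auto simp: unif_def not_le split: if_splits)
  moreover have "(\<Sum>i<k. if unif m i = 0 then 0 else unif m i * ln (unif m i / q i))
     = (\<Sum>i<m. (1 / real m) * ln ((1 / real m) / q i))"
    using assms by (intro sum.mono_neutral_cong_right) (auto simp: unif_def)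
  ultimately show ?thesis by (simp add: KL_def)
qed

text \<open>The profile in the denominator counts \<open>i\<close> itself, and above the threshold
  the count is at least 1.\<close>

lemma mgt_weight_pos:
  assumes "n \<ge> 1" "i < k"
  shows "mgt_weight n k y0 N i > 0"
proof -
  have "finite {j. j < k \<and> N j = N i}" "i \<in> {j. j < k \<and> N j = N i}" using assms by auto
  then have "profile k N (N i) > 0" unfolding profile_def using card_gt_0_iff by blast
  then show ?thesis using assms by (auto simp: mgt_weight_def)
qed

lemma KL_MGT_ge:
  assumes "n \<ge> 1" "0 < m" "m \<le> k"
  shows "ennreal ((\<Sum>i<m. \<Sum>j<m. gap (mgt_weight n k y0 N i) (mgt_weight n k y0 N j)) / (real m)\<^sup>2)
           \<le> KL k (unif m) (MGT n k y0 N)"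
proof -
  let ?w = "mgt_weight n k y0 N"
  have w: "?w i > 0" if "i < k" for i using mgt_weight_pos assms that by auto
  have S: "(\<Sum>i<k. ?w i) > 0" using w assms by (intro sum_pos) (auto simp: lessThan_empty_iff)
  have "(\<Sum>i<m. ?w i) \<le> (\<Sum>i<k. ?w i)"
    using assms w by (intro sum_mono2) (auto intro: less_imp_le)
  then have "(\<Sum>i<m. \<Sum>j<m. gap (?w i) (?w j)) / (real m)\<^sup>2
     \<le> (\<Sum>i<m. (1 / real m) * ln ((1 / real m) / (?w i / (\<Sum>i<k. ?w i))))"
    using assms w by (intro mean_gap_le_KL) auto
  also have "\<dots> = (\<Sum>i<m. (1 / real m) * ln ((1 / real m) / MGT n k y0 N i))"
    using assms by (intro sum.cong refl) (auto simp: MGT_def)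
  finally show ?thesis
    using assms w S by (subst KL_unif) (auto simp: MGT_def intro: ennreal_leI)
qed

text \<open>The \<open>m * (m - 1)\<close> ordered pairs of distinct symbols make up at least half
  of all \<open>m * m\<close> pairs, whence the factor 1/2.\<close>

lemma risk_MGT_ge:
  assumes n: "n \<ge> 1" and m: "m \<ge> 2" "m \<le> k" and a: "a \<ge> 0"
    and pair: "\<And>i j. i < m \<Longrightarrow> j < m \<Longrightarrow> i \<noteq> j \<Longrightarrow>
      ennreal a \<le> (\<integral>\<^sup>+N. ennreal (gap (mgt_weight n k y0 N i) (mgt_weight n k y0 N j))
                      \<partial>measure_pmf (count_law n k (unif m)))"
  shows "ennreal (a / 2) \<le> risk n k (unif m) (MGT n k y0)"
proof -
  let ?M = "measure_pmf (count_law n k (unif m))"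
  let ?g = "\<lambda>N i j. gap (mgt_weight n k y0 N i) (mgt_weight n k y0 N j)"
  let ?D = "{x \<in> {..<m} \<times> {..<m}. fst x \<noteq> snd x}"
  have D: "?D = Sigma {..<m} (\<lambda>i. {..<m} - {i})" by auto
  have "card ?D = (\<Sum>i<m. card ({..<m} - {i}))" unfolding D by (intro card_SigmaI) auto
  also have "\<dots> = m * (m - 1)" by simp
  finally have card: "real (card ?D) = real m * (real m - 1)" using m by (simp add: of_nat_diff)
  have "a / 2 \<le> real (card ?D) * a / (real m)\<^sup>2"
  proof -

    have "real m * 2 \<le> real m * real m" using m by (intro mult_left_mono) auto
    then have "a * (real m * real m) \<le> a * (2 * (real m * (real m - 1)))"
      using a by (intro mult_left_mono) (auto simp: algebra_simps)
    then show ?thesis using m unfolding card by (simp add: field_simps power2_eq_square)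
  qed
  then have "ennreal (a / 2) \<le> ennreal (real (card ?D) * a / (real m)\<^sup>2)" by (rule ennreal_leI)
  also have "\<dots> = ennreal (1 / (real m)\<^sup>2) * (\<Sum>x\<in>?D. ennreal a)"
    using a by (simp add: ennreal_mult[symmetric] ennreal_of_nat_eq_real_of_nat field_simps flip: ennreal_mult)
  also have "\<dots> \<le> ennreal (1 / (real m)\<^sup>2) * (\<Sum>x\<in>?D. \<integral>\<^sup>+N. ennreal (?g N (fst x) (snd x)) \<partial>?M)"
    using pair by (intro mult_left_mono sum_mono) auto
  also have "\<dots> = (\<integral>\<^sup>+N. ennreal (1 / (real m)\<^sup>2) * (\<Sum>x\<in>?D. ennreal (?g N (fst x) (snd x))) \<partial>?M)"
    by (simp add: nn_integral_cmult nn_integral_sum)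
  also have "\<dots> \<le> (\<integral>\<^sup>+N. KL k (unif m) (MGT n k y0 N) \<partial>?M)"
  proof (intro nn_integral_mono)
    fix N
    have "(\<Sum>x\<in>?D. ?g N (fst x) (snd x)) \<le> (\<Sum>x\<in>{..<m}\<times>{..<m}. ?g N (fst x) (snd x))"
      by (intro sum_mono2) (auto intro: gap_nonneg)
    also have "\<dots> = (\<Sum>i<m. \<Sum>j<m. ?g N i j)" by (simp add: sum.cartesian_product split_def)
    finally have le: "(\<Sum>x\<in>?D. ?g N (fst x) (snd x)) \<le> (\<Sum>i<m. \<Sum>j<m. ?g N i j)" .
    have "ennreal (1 / (real m)\<^sup>2) * (\<Sum>x\<in>?D. ennreal (?g N (fst x) (snd x)))
        = ennreal ((\<Sum>x\<in>?D. ?g N (fst x) (snd x)) / (real m)\<^sup>2)"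
      by (simp add: gap_nonneg sum_nonneg flip: ennreal_mult)
    also have "\<dots> \<le> ennreal ((\<Sum>i<m. \<Sum>j<m. ?g N i j) / (real m)\<^sup>2)"
      using le by (intro ennreal_leI divide_right_mono) auto
    also have "\<dots> \<le> KL k (unif m) (MGT n k y0 N)"
      using n m by (intro KL_MGT_ge) auto
    finally show "ennreal (1 / (real m)\<^sup>2) * (\<Sum>x\<in>?D. ennreal (?g N (fst x) (snd x)))
        \<le> KL k (unif m) (MGT n k y0 N)" .
  qed
  finally show ?thesis by (simp add: risk_def)
qed

lemma count_law_unif:
  assumes "n \<ge> 1"
  shows "count_law n k (unif m) =
    Pi_pmf {..<k} 0 (\<lambda>i. if i < m then poisson_pmf (real n / real m) else return_pmf 0)"
  unfolding count_law_def using assms by (intro Pi_pmf_cong) (auto simp: poi_def unif_def)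

section \<open>From risk to regret: upper bounds for the oracle\<close>

lemma regret_ge:
  assumes p: "p \<in> prob_simplex k" and lo: "ennreal a \<le> risk n k p e" and up: "oracle_risk n k p \<le> ennreal b"
    and "0 \<le> a" "0 \<le> b" and c: "c \<le> a - b"
  shows "ereal c \<le> regret n k e"
proof -
  have "ereal a \<le> enn2ereal (risk n k p e)"
    using lo assms by (metis enn2ereal_ennreal less_eq_ennreal.rep_eq)
  moreover have "enn2ereal (oracle_risk n k p) \<le> ereal b"
    using up assms by (metis enn2ereal_ennreal less_eq_ennreal.rep_eq)
  ultimately have "ereal a - ereal b \<le> enn2ereal (risk n k p e) - enn2ereal (oracle_risk n k p)"
    by (rule ereal_minus_mono)
  also have "\<dots> \<le> regret n k e" unfolding regret_def using p by (rule SUP_upper)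
  finally show ?thesis using c by (metis ereal_less_eq(3) ereal_minus(1) order_trans)
qed

text \<open>The constant estimator \<open>unif k\<close> is permutation invariant, since
  permutations of all symbols fix it, and it equals the truth.\<close>

lemma oracle_risk_unif_full:
  assumes "k \<ge> 1"
  shows "oracle_risk n k (unif k) = 0"
proof -
  let ?e = "\<lambda>N::nat \<Rightarrow> nat. unif k"
  have "?e \<in> PI_estimators k"
  proof -
    have "unif k (\<pi> i) = unif k i" if "\<pi> permutes {..<k}" for \<pi> i
      using permutes_in_image[OF that, of i] by (simp add: unif_def)
    then show ?thesis using unif_in_prob_simplex[of k k] assms by (auto simp: PI_estimators_def estimators_def)
  qed
  moreover have "risk n k (unif k) ?e = 0"
    using assms by (simp add: risk_def KL_unif unif_def)
  ultimately have "oracle_risk n k (unif k) \<le> 0" unfolding oracle_risk_def by (metis INF_lower)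
  then show ?thesis by simp
qed

text \<open>The competitor gives weight \<open>\<epsilon>\<close> to zero counts and weight 1 to
  positive ones. Mass leaking to symbols outside the support costs at most
  \<open>\<epsilon> * real k / real m\<close>; a support symbol with count zero, an event of
  probability \<open>exp (- (real n / real m))\<close>, costs
  \<open>ln (1 / \<epsilon>)\<close>.\<close>

lemma oracle_risk_unif_le:
  assumes n: "n \<ge> 1" and m: "1 \<le> m" "m \<le> k" and \<epsilon>: "0 < \<epsilon>" "\<epsilon> \<le> 1"
  shows "oracle_risk n k (unif m)
          \<le> ennreal (\<epsilon> * real k / real m + exp (- (real n / real m)) * ln (1 / \<epsilon>))"
proof -
  define v where "v y = (if y = 0 then \<epsilon> else 1)" for y :: nat
  define e where "e N = (\<lambda>i. if i < k then v (N i) / (\<Sum>j<k. v (N j)) else 0)" for N :: "nat \<Rightarrow> nat"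
  let ?M = "measure_pmf (count_law n k (unif m))"
  let ?lam = "real n / real m"
  have v: "v y > 0" for y using \<epsilon> by (simp add: v_def)
  have S: "(\<Sum>j<k. v (N j)) > 0" for N using v m by (intro sum_pos) (auto simp: lessThan_empty_iff)
  have "e \<in> PI_estimators k"
  proof -
    have "e N \<in> prob_simplex k" for N
      using S[of N] v by (auto simp: prob_simplex_def e_def less_imp_le simp flip: sum_divide_distrib)
    moreover have "e (\<lambda>i. N (\<pi> i)) = (\<lambda>i. e N (\<pi> i))" if "\<pi> permutes {..<k}" for \<pi> N
    proof
      fix i
      have "(\<Sum>j<k. v (N (\<pi> j))) = (\<Sum>j<k. v (N j))"
        using sum.permute[OF that, of "\<lambda>j. v (N j)"] by (simp add: o_def)
      then show "e (\<lambda>i. N (\<pi> i)) i = e N (\<pi> i)"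
        using permutes_in_image[OF that, of i] by (simp add: e_def)
    qed
    ultimately show ?thesis by (auto simp: PI_estimators_def estimators_def)
  qed
  then have "oracle_risk n k (unif m) \<le> risk n k (unif m) e"
    unfolding oracle_risk_def by (rule INF_lower)
  also have "\<dots> \<le> (\<integral>\<^sup>+N. ennreal (\<epsilon> * real k / real m) +
       (\<Sum>i<m. ennreal (ln (1 / \<epsilon>) / real m) * indicator {N. N i = 0} N) \<partial>?M)"
    unfolding risk_def
  proof (intro nn_integral_mono_AE AE_pmfI)
    fix N assume "N \<in> set_pmf (count_law n k (unif m))"
    \<comment> \<open>Symbols outside the support almost surely have count zero, so each of them
      contributes exactly \<open>\<epsilon>\<close> to the normalizer.\<close>
    then have N0: "N i = 0" if "i \<ge> m" for i
    proof (cases "i < k")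
      case True
      have "N i \<in> set_pmf (if i < m then poisson_pmf ?lam else return_pmf 0)"
        using \<open>N \<in> _\<close> True n by (subst (asm) count_law_unif) (auto simp: set_Pi_pmf PiE_dflt_def)
      then show ?thesis using that by simp
    next
      case False
      then show ?thesis using \<open>N \<in> _\<close> n by (subst (asm) count_law_unif) (auto simp: set_Pi_pmf PiE_dflt_def)
    qed
    define T where "T = (\<Sum>j<k. v (N j))"
    have T: "T > 0" using S by (simp add: T_def)
    have "T = (\<Sum>j<m. v (N j)) + (\<Sum>j\<in>{m..<k}. v (N j))"
      unfolding T_def using m by (metis lessThan_atLeast0 le0 sum.atLeastLessThan_concat)
    also have "\<dots> \<le> (\<Sum>j<m. 1) + (\<Sum>j\<in>{m..<k}. \<epsilon>)"
      using \<epsilon> N0 by (intro add_mono sum_mono) (auto simp: v_def)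
    also have "\<dots> \<le> real m + \<epsilon> * real k" using m \<epsilon> by (simp add: algebra_simps)
    finally have "T / real m \<le> 1 + \<epsilon> * real k / real m" using m by (simp add: field_simps)
    then have lnT: "ln (T / real m) \<le> \<epsilon> * real k / real m"
      using ln_le_minus_one[of "T / real m"] T m by simp
    have "(\<Sum>i<m. (1 / real m) * ln ((1 / real m) / e N i))
        = (\<Sum>i<m. (1 / real m) * (ln (T / real m) + ln (1 / \<epsilon>) * indicator {N. N i = 0} N))"
    proof (intro sum.cong refl)
      fix i assume "i \<in> {..<m}"
      then have "e N i = v (N i) / T" using m by (simp add: e_def T_def)
      then show "(1 / real m) * ln ((1 / real m) / e N i)
          = (1 / real m) * (ln (T / real m) + ln (1 / \<epsilon>) * indicator {N. N i = 0} N)"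
        using m T \<epsilon> by (auto simp: v_def indicator_def ln_div ln_mult)
    qed
    also have "\<dots> = ln (T / real m) + (\<Sum>i<m. ln (1 / \<epsilon>) / real m * indicator {N. N i = 0} N)"
      using m by (simp add: sum.distrib algebra_simps)
    also have "\<dots> \<le> \<epsilon> * real k / real m + (\<Sum>i<m. ln (1 / \<epsilon>) / real m * indicator {N. N i = 0} N)"
      using lnT by simp
    finally have le: "(\<Sum>i<m. (1 / real m) * ln ((1 / real m) / e N i)) \<le> \<dots>" .
    have lnn: "0 \<le> ln (1 / \<epsilon>) / real m" using \<epsilon> by (intro divide_nonneg_nonneg) auto
    have "KL k (unif m) (e N) = ennreal (\<Sum>i<m. (1 / real m) * ln ((1 / real m) / e N i))"
      using m T v by (intro KL_unif) (auto simp: e_def T_def[symmetric])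
    also have "\<dots> \<le> ennreal (\<epsilon> * real k / real m + (\<Sum>i<m. ln (1 / \<epsilon>) / real m * indicator {N. N i = 0} N))"
      using le by (rule ennreal_leI)
    also have "\<dots> = ennreal (\<epsilon> * real k / real m) +
       (\<Sum>i<m. ennreal (ln (1 / \<epsilon>) / real m) * indicator {N. N i = 0} N)"
    proof -
      have "(\<Sum>i<m. ennreal (ln (1 / \<epsilon>) / real m) * indicator {N. N i = 0} N)
        = (\<Sum>i<m. ennreal (ln (1 / \<epsilon>) / real m * indicator {N. N i = 0} N))"
        by (intro sum.cong refl) (auto split: split_indicator)
      also have "\<dots> = ennreal (\<Sum>i<m. ln (1 / \<epsilon>) / real m * indicator {N. N i = 0} N)"
        using lnn by (intro sum_ennreal mult_nonneg_nonneg) auto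
      finally show ?thesis
        using \<epsilon> lnn by (simp only:, subst ennreal_plus) (auto intro!: sum_nonneg mult_nonneg_nonneg simp del: times_divide_eq_left)
    qed
    finally show "KL k (unif m) (e N) \<le> \<dots>" .
  qed
  also have "\<dots> = ennreal (\<epsilon> * real k / real m) +
       (\<Sum>i<m. ennreal (ln (1 / \<epsilon>) / real m) * emeasure ?M {N. N i = 0})"
    by (subst nn_integral_add, simp, simp, subst nn_integral_sum)
      (simp_all add: nn_integral_cmult_indicator del: sum_mult_indicator)
  also have "(\<Sum>i<m. ennreal (ln (1 / \<epsilon>) / real m) * emeasure ?M {N. N i = 0})
     = (\<Sum>i<m. ennreal (ln (1 / \<epsilon>) / real m * exp (- ?lam)))"
  proof (intro sum.cong refl)
    fix i assume "i \<in> {..<m}"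
    then have i: "i < m" "i < k" using m by auto
    have "map_pmf (\<lambda>N. N i) (count_law n k (unif m)) = poisson_pmf ?lam"
      using i n by (simp add: count_law_unif Pi_pmf_component)
    then have "pmf (map_pmf (\<lambda>N. N i) (count_law n k (unif m))) 0 = exp (- ?lam)"
      using n m by simp
    moreover have "pmf (map_pmf (\<lambda>N. N i) (count_law n k (unif m))) 0
        = measure ?M {N. N i = 0}"
      by (simp add: pmf_map vimage_def)
    ultimately have "emeasure ?M {N. N i = 0} = ennreal (exp (- ?lam))"
      by (simp add: measure_pmf.emeasure_eq_measure)
    then show "ennreal (ln (1 / \<epsilon>) / real m) * emeasure ?M {N. N i = 0}
      = ennreal (ln (1 / \<epsilon>) / real m * exp (- ?lam))"
      by (simp add: mult_ac flip: ennreal_mult'')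
  qed
  also have "\<dots> = ennreal (exp (- ?lam) * ln (1 / \<epsilon>))"
  proof -
    have "0 \<le> ln (1 / \<epsilon>)" using \<epsilon> by simp
    then have "0 \<le> ln (1 / \<epsilon>) / real m * exp (- ?lam)"
      by (intro mult_nonneg_nonneg divide_nonneg_nonneg) auto
    then show ?thesis using m by (subst sum_ennreal) (auto simp: mult_ac)
  qed
  also have "ennreal (\<epsilon> * real k / real m) + \<dots> = ennreal (\<epsilon> * real k / real m + exp (- ?lam) * ln (1 / \<epsilon>))"
    using \<epsilon> by (intro ennreal_plus[symmetric] mult_nonneg_nonneg divide_nonneg_nonneg) auto
  finally show ?thesis .
qed

section \<open>Poisson tails and local estimates\<close>

lemma pmf_poisson_Suc:
  assumes "r > 0"
  shows "pmf (poisson_pmf r) (Suc y) = pmf (poisson_pmf r) y * (r / real (Suc y))"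
  using assms by (simp add: field_simps)

text \<open>The ratio \<open>r / real (Suc y)\<close> of successive masses passes 1 at
  \<open>\<lfloor>r\<rfloor>\<close>: the masses increase up to there and decrease
  afterwards.\<close>

lemma pmf_poisson_le_mode:
  assumes r: "r > 0"
  shows "pmf (poisson_pmf r) y \<le> pmf (poisson_pmf r) (nat \<lfloor>r\<rfloor>)"
proof -
  let ?P = "pmf (poisson_pmf r)"
  have up: "?P y \<le> ?P (Suc y)" if "real (Suc y) \<le> r" for y
  proof -
    have "?P y * 1 \<le> ?P y * (r / real (Suc y))" using that by (intro mult_left_mono) (auto simp: pmf_nonneg)
    then show ?thesis using pmf_poisson_Suc[OF r] by simp
  qed
  have down: "?P (Suc y) \<le> ?P y" if "r \<le> real (Suc y)" for y
  proof -
    have "?P y * (r / real (Suc y)) \<le> ?P y * 1" using that by (intro mult_left_mono) (auto simp: pmf_nonneg)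
    then show ?thesis using pmf_poisson_Suc[OF r] by simp
  qed
  show ?thesis
  proof (cases "y \<le> nat \<lfloor>r\<rfloor>")
    case True
    then show ?thesis
    proof (induction rule: inc_induct)
      case (step z)
      then have "real (Suc z) \<le> r" using r by linarith
      then show ?case using up step.IH order_trans by blast
    qed simp
  next
    case False
    then have "nat \<lfloor>r\<rfloor> \<le> y" by simp
    then show ?thesis
    proof (induction rule: dec_induct)
      case (step z)
      then have "r \<le> real (Suc z)" using r by linarith
      then show ?case using down step.IH order_trans by blast
    qed simp
  qed
qed

text \<open>In each of the \<open>J\<close> steps after the mode \<open>M\<close> the mass shrinks
  at most by the factor \<open>exp (- real J / r)\<close>, so in total at most by
  \<open>exp (- 1)\<close>, as \<open>J * J \<le> r\<close>. More than \<open>J\<close> values thus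
  have mass at least \<open>exp (- 1)\<close> times the maximum, and their sum is at most 1.\<close>

lemma pmf_poisson_le:
  assumes r: "r > 0"
  shows "pmf (poisson_pmf r) y \<le> exp 1 / sqrt r"
proof -
  let ?P = "pmf (poisson_pmf r)"
  define M where "M = nat \<lfloor>r\<rfloor>"
  define J where "J = nat \<lfloor>sqrt r\<rfloor>"
  have J: "real J \<le> sqrt r" "sqrt r \<le> real J + 1" using r by (auto simp: J_def)
  have "real J * real J \<le> sqrt r * sqrt r" using J r by (intro mult_mono) auto
  then have JJ: "real J * real J \<le> r" using r by simp
  have M: "real M \<le> r" using r by (simp add: M_def)
  have step: "?P M * exp (- real J / r) ^ i \<le> ?P (M + i)" if "i \<le> J" for i
    using that
  proof (induction i)
    case (Suc i)
    have "exp (- real J / r) \<le> r / real (Suc (M + i))"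
    proof -
      have "real (Suc (M + i)) \<le> r + real J" using Suc.prems M by linarith
      also have "\<dots> = r * (1 + real J / r)" using r by (simp add: field_simps)
      also have "\<dots> \<le> r * exp (real J / r)" using r exp_ge_add_one_self by (intro mult_left_mono) auto
      finally show ?thesis using r by (simp add: exp_minus field_simps)
    qed
    then have "(?P M * exp (- real J / r) ^ i) * exp (- real J / r) \<le> ?P (M + i) * (r / real (Suc (M + i)))"
      using Suc by (intro mult_mono) (auto simp: pmf_nonneg)
    then show ?case using pmf_poisson_Suc[OF r, of "M + i"] by (simp add: mult_ac)
  qed simp
  have "?P M * exp (- 1) \<le> ?P (M + i)" if "i \<le> J" for i
  proof -
    have "real i * real J \<le> real J * real J" using that by (intro mult_right_mono) auto
    then have "real i * real J / r \<le> 1" using JJ r by (simp add: field_simps)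
    then have "exp (- 1) \<le> exp (- real J / r) ^ i"
      by (simp add: exp_of_nat_mult[symmetric])
    then have "?P M * exp (- 1) \<le> ?P M * exp (- real J / r) ^ i"
      by (intro mult_left_mono) (auto simp: pmf_nonneg)
    also have "\<dots> \<le> ?P (M + i)" using step that by blast
    finally show ?thesis .
  qed
  then have "(\<Sum>i\<le>J. ?P M * exp (- 1)) \<le> (\<Sum>i\<le>J. ?P (M + i))" by (intro sum_mono) auto
  also have "\<dots> = sum ?P ((+) M ` {..J})" by (subst sum.reindex) auto
  also have "\<dots> = measure (poisson_pmf r) ((+) M ` {..J})" by (simp add: measure_measure_pmf_finite)
  also have "\<dots> \<le> 1" by simp
  finally have "(real J + 1) * (?P M * exp (- 1)) \<le> 1" by (simp add: add.commute)
  moreover have "sqrt r * (?P M * exp (- 1)) \<le> (real J + 1) * (?P M * exp (- 1))"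
    using J by (intro mult_right_mono) (auto simp: pmf_nonneg)
  ultimately have "sqrt r * (?P M * exp (- 1)) \<le> 1" by linarith
  then have "?P M \<le> exp 1 / sqrt r" using r by (simp add: exp_minus field_simps)
  then show ?thesis using pmf_poisson_le_mode[OF r, of y] unfolding M_def by linarith
qed

text \<open>Since \<open>Suc y\<close> times the mass at \<open>Suc y\<close> is \<open>r\<close>
  times the mass at \<open>y\<close>, a factor \<open>y\<close> can be traded for \<open>r\<close>
  and an index shift. Two applications give the first and second moments.\<close>

lemma poisson_variance_sums:
  assumes r: "r > 0"
  shows "(\<lambda>y. pmf (poisson_pmf r) y * (real y - r)\<^sup>2) sums r"
proof -
  let ?P = "pmf (poisson_pmf r)"
  have s0: "?P sums 1"
  proof -
    have "(\<lambda>y. r ^ y / fact y) sums exp r"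
      using exp_converges[of r] by (simp add: divide_inverse mult.commute)
    moreover have "?P = (\<lambda>y. r ^ y / fact y * exp (- r))" using r by (intro ext) simp
    ultimately show ?thesis using sums_mult2[of "\<lambda>y. r ^ y / fact y" "exp r" "exp (- r)"]
      by (simp add: mult_exp_exp)
  qed
  have shift: "(\<lambda>y. ?P y * real y * g y) sums (r * a)" if "(\<lambda>y. ?P y * g (Suc y)) sums a" for g a
  proof -
    have "(\<lambda>y. ?P (Suc y) * real (Suc y) * g (Suc y)) = (\<lambda>y. r * (?P y * g (Suc y)))"
      unfolding pmf_poisson_Suc[OF r] by (intro ext) (simp del: pmf_poisson)
    then have "(\<lambda>y. ?P (Suc y) * real (Suc y) * g (Suc y)) sums (r * a)"
      using sums_mult[OF that, of r] by simp
    then show ?thesis by (subst (asm) sums_Suc_iff) simp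
  qed
  have s1: "(\<lambda>y. ?P y * real y) sums r"
    using shift[of "\<lambda>_. 1" 1] s0 by simp
  have s2: "(\<lambda>y. ?P y * real y * real y) sums (r * (r + 1))"
  proof (rule shift)
    show "(\<lambda>y. ?P y * real (Suc y)) sums (r + 1)"
      using sums_add[OF s1 s0] by (simp add: algebra_simps del: pmf_poisson)
  qed
  have "(\<lambda>y. ?P y * real y * real y + (- 2 * r) * (?P y * real y) + r\<^sup>2 * ?P y)
     sums (r * (r + 1) + (- 2 * r) * r + r\<^sup>2 * 1)"
    by (intro sums_add sums_mult s0 s1 s2)
  then show ?thesis by (simp add: power2_eq_square algebra_simps del: pmf_poisson)
qed

lemma poisson_chebyshev:
  assumes r: "r > 0" and a: "a > 0"
  shows "measure (poisson_pmf r) {y. a \<le> \<bar>real y - r\<bar>} \<le> r / a\<^sup>2"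
proof -
  have "emeasure (poisson_pmf r) {y. a \<le> \<bar>real y - r\<bar>}
      = (\<integral>\<^sup>+y. indicator {y. a \<le> \<bar>real y - r\<bar>} y \<partial>measure_pmf (poisson_pmf r))"
    by simp
  also have "\<dots> \<le> (\<integral>\<^sup>+y. ennreal ((real y - r)\<^sup>2 / a\<^sup>2) \<partial>measure_pmf (poisson_pmf r))"
  proof (intro nn_integral_mono)
    fix y
    have "1 \<le> (real y - r)\<^sup>2 / a\<^sup>2" if "a \<le> \<bar>real y - r\<bar>"
      using that a power_mono[of a "\<bar>real y - r\<bar>" 2] by simp
    then show "indicator {y. a \<le> \<bar>real y - r\<bar>} y \<le> ennreal ((real y - r)\<^sup>2 / a\<^sup>2)"
      by (auto simp: indicator_def simp flip: ennreal_1 intro!: ennreal_leI)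
  qed
  also have "\<dots> = (\<Sum>y. ennreal (pmf (poisson_pmf r) y * (real y - r)\<^sup>2 / a\<^sup>2))"
    by (simp add: nn_integral_measure_pmf nn_integral_count_space_nat flip: ennreal_mult' del: pmf_poisson)
  also have "\<dots> = ennreal (r / a\<^sup>2)"
    using sums_divide[OF poisson_variance_sums[OF r], of "a\<^sup>2"]
    by (intro suminf_ennreal_eq) (auto simp: pmf_nonneg)
  finally show ?thesis using r by (simp add: measure_pmf.emeasure_eq_measure)
qed

text \<open>Finds where the upper tail first drops to \<open>4 / real m\<close>. Near the mean some
  mass is above this value, near \<open>3 / 2 * r\<close> Chebyshev's inequality puts it below, and
  \<open>Suc z\<close> is the first place of descent in between.\<close>

lemma poisson_level:
  assumes m: "real m \<le> r" "r \<le> 2 * real m" and r: "r \<ge> 3000"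
  obtains z where "pmf (poisson_pmf r) z > 4 / real m" "pmf (poisson_pmf r) (Suc z) \<le> 4 / real m"
    "r < real (Suc z)" "real z + 3 \<le> 2 * r"
proof -
  let ?P = "pmf (poisson_pmf r)"
  have r0: "r > 0" and m0: "real m > 0" using r m by linarith+
  have sr: "sqrt r > 54" using r by (intro real_less_rsqrt) simp
  have rr: "sqrt r * sqrt r = r" using r0 by simp
  \<comment> \<open>Otherwise at most \<open>4 * sqrt r + 1\<close> values, each of mass at most
    \<open>4 / real m \<le> 8 / r\<close>, would carry the probability 3/4 that Chebyshev's
    inequality guarantees. The bound \<open>r \<ge> 3000\<close> makes this impossible.\<close>
  have "\<exists>y. \<bar>real y - r\<bar> < 2 * sqrt r \<and> ?P y > 4 / real m"
  proof (rule ccontr)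
    assume "\<not> ?thesis"
    then have small: "?P y \<le> 4 / real m" if "\<bar>real y - r\<bar> < 2 * sqrt r" for y using that by force
    let ?A = "{y. \<bar>real y - r\<bar> < 2 * sqrt r}"
    define a where "a = nat \<lceil>r - 2 * sqrt r\<rceil>"
    define b where "b = nat \<lfloor>r + 2 * sqrt r\<rfloor>"
    have sub: "?A \<subseteq> {a..b}" unfolding a_def b_def by (auto simp: le_nat_iff ceiling_le_iff le_floor_iff)
    then have fin: "finite ?A" by (rule finite_subset) simp
    have ab: "real (b + 1 - a) \<le> 4 * sqrt r + 1"
    proof -
      have "r - 2 * sqrt r \<le> real a" unfolding a_def by linarith
      moreover have "real b \<le> r + 2 * sqrt r" unfolding b_def using r0 by (simp add: floor_le_iff)
      moreover have "0 \<le> sqrt r" using r0 by simp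
      ultimately show ?thesis by linarith
    qed
    have "card ?A \<le> b + 1 - a" using card_mono[OF _ sub] by simp
    then have card: "real (card ?A) \<le> 4 * sqrt r + 1" using ab by linarith
    have "1 - measure (poisson_pmf r) {y. 2 * sqrt r \<le> \<bar>real y - r\<bar>} = measure (poisson_pmf r) ?A"
    proof -
      have "?A = UNIV - {y. 2 * sqrt r \<le> \<bar>real y - r\<bar>}" by auto
      then show ?thesis using measure_pmf.prob_compl[of "{y. 2 * sqrt r \<le> \<bar>real y - r\<bar>}" "poisson_pmf r"] by simp
    qed
    moreover have "measure (poisson_pmf r) {y. 2 * sqrt r \<le> \<bar>real y - r\<bar>} \<le> r / (2 * sqrt r)\<^sup>2"
      using r0 by (intro poisson_chebyshev) auto
    moreover have "r / (2 * sqrt r)\<^sup>2 = 1 / 4" using r0 by (simp add: power_mult_distrib)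
    moreover have "measure (poisson_pmf r) ?A \<le> real (card ?A) * (4 / real m)"
    proof -
      have "measure (poisson_pmf r) ?A = sum ?P ?A" using fin by (rule measure_measure_pmf_finite)
      also have "\<dots> \<le> (\<Sum>y\<in>?A. 4 / real m)" using small by (intro sum_mono) auto
      finally show ?thesis by simp
    qed
    moreover have "real (card ?A) * (4 / real m) \<le> (4 * sqrt r + 1) * (8 / r)"
      using card m m0 r0 by (intro mult_mono) (auto simp: field_simps)
    moreover have "(4 * sqrt r + 1) * (8 / r) < 3 / 4"
    proof -
      have "32 * (4 * sqrt r + 1) < 3 * r"
      proof -
        have "54 * sqrt r \<le> sqrt r * sqrt r" using sr r0 by (intro mult_right_mono) auto
        then have "54 * sqrt r \<le> r" unfolding rr .
        then have "128 * sqrt r + 32 < 3 * r" using sr by linarith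
        then show ?thesis by simp
      qed
      then show ?thesis using r0 by (simp add: field_simps)
    qed
    ultimately show False by linarith
  qed
  then obtain y0 where y0: "\<bar>real y0 - r\<bar> < 2 * sqrt r" "?P y0 > 4 / real m" by blast
  define U where "U = nat \<lceil>3 / 2 * r\<rceil>"
  have U: "3 / 2 * r \<le> real U" "real U \<le> 3 / 2 * r + 1" using r0 unfolding U_def by linarith+
  have "?P U \<le> 4 / real m"
  proof -
    have "?P U = measure (poisson_pmf r) {U}" by (simp add: measure_pmf_single del: pmf_poisson)
    also have "\<dots> \<le> measure (poisson_pmf r) {y. r / 2 \<le> \<bar>real y - r\<bar>}"
      using U by (intro measure_pmf.finite_measure_mono) auto
    also have "\<dots> \<le> r / (r / 2)\<^sup>2" using r0 by (intro poisson_chebyshev) auto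
    also have "\<dots> \<le> 4 / real m" using m m0 r0 by (simp add: power2_eq_square field_simps)
    finally show ?thesis .
  qed
  moreover have "y0 \<le> U"
  proof -
    have "54 * sqrt r \<le> sqrt r * sqrt r" using sr r0 by (intro mult_right_mono) auto
    then have "54 * sqrt r \<le> r" unfolding rr .
    then have "real y0 \<le> real U" using y0 U by linarith
    then show ?thesis by simp
  qed
  ultimately have ex: "y0 \<le> U \<and> ?P U \<le> 4 / real m" by simp
  define y where "y = (LEAST y. y0 \<le> y \<and> ?P y \<le> 4 / real m)"
  have y: "y0 \<le> y" "?P y \<le> 4 / real m" using LeastI[of "\<lambda>y. y0 \<le> y \<and> ?P y \<le> 4 / real m", OF ex] unfolding y_def by auto
  have yU: "y \<le> U" unfolding y_def using ex by (rule Least_le)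
  have "y \<noteq> y0" using y y0 by auto
  then obtain z where z: "y = Suc z" "y0 \<le> z" using y by (cases y) auto
  have zP: "?P z > 4 / real m"
  proof (rule ccontr)
    assume "\<not> ?thesis"
    then have "y \<le> z" unfolding y_def using z by (intro Least_le) auto
    then show False using z by simp
  qed
  \<comment> \<open>Up to the mean the masses do not decrease, so a descent from \<open>z\<close> to
    \<open>Suc z\<close> happens only beyond it.\<close>
  have "r < real (Suc z)"
  proof (rule ccontr)
    assume "\<not> ?thesis"
    then have "?P z * 1 \<le> ?P z * (r / real (Suc z))" by (intro mult_left_mono) (auto simp: pmf_nonneg)
    then show False using zP y z pmf_poisson_Suc[OF r0, of z] by simp
  qed
  moreover have "real z + 3 \<le> 2 * r"
  proof -
    have "real z + 1 \<le> real U" using yU z by simp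
    then show ?thesis using U r by linarith
  qed
  ultimately show ?thesis using that zP y z by blast
qed

section \<open>Small thresholds: empirical weights\<close>

text \<open>The index set is a parameter so that the count of a single symbol can be split off and
  averaged separately.\<close>

abbreviation unif_counts :: "nat \<Rightarrow> real \<Rightarrow> nat set \<Rightarrow> (nat \<Rightarrow> nat) pmf" where
  "unif_counts m r A \<equiv> Pi_pmf A 0 (\<lambda>i. if i < m then poisson_pmf r else return_pmf 0)"

text \<open>By independence, the count of \<open>l\<close> may be redrawn with all other counts held
  fixed.\<close>

lemma nn_integral_unif_counts_split:
  assumes "finite A" "l \<in> A" "l < m"
  shows "(\<integral>\<^sup>+N. h N \<partial>measure_pmf (unif_counts m r A))
    = (\<integral>\<^sup>+f. (\<integral>\<^sup>+v. h (f(l := v)) \<partial>measure_pmf (poisson_pmf r)) \<partial>measure_pmf (unif_counts m r (A - {l})))"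
proof -
  have A: "A = insert l (A - {l})" using assms by auto
  have "unif_counts m r A = map_pmf (\<lambda>(y,f). f(l := y)) (pair_pmf (poisson_pmf r) (unif_counts m r (A - {l})))"
    using assms by (subst A, subst Pi_pmf_insert) auto
  also have "\<dots> = map_pmf (\<lambda>(f,y). f(l := y)) (pair_pmf (unif_counts m r (A - {l})) (poisson_pmf r))"
    by (subst pair_commute_pmf) (simp add: map_pmf_comp case_prod_unfold)
  finally show ?thesis by (simp add: nn_integral_pair_pmf' case_prod_unfold)
qed

text \<open>At most \<open>2 * d + 1\<close> integers lie within \<open>d\<close> of
  \<open>u\<close>, and each has mass at most \<open>exp 1 / sqrt r\<close>.\<close>

lemma prob_poisson_near_le:
  assumes r: "r > 0" and d: "d \<ge> 0"
  shows "measure (poisson_pmf r) {v. \<bar>real v - real u\<bar> \<le> d} \<le> (2 * d + 1) * (exp 1 / sqrt r)"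
proof -
  let ?A = "{v. \<bar>real v - real u\<bar> \<le> d}"
  have sub: "int ` ?A \<subseteq> {\<lceil>real u - d\<rceil>..\<lfloor>real u + d\<rfloor>}"
  proof clarify
    fix v assume "\<bar>real v - real u\<bar> \<le> d"
    then have "real u - d \<le> real_of_int (int v)" "real_of_int (int v) \<le> real u + d" by auto
    then show "int v \<in> {\<lceil>real u - d\<rceil>..\<lfloor>real u + d\<rfloor>}"
      unfolding atLeastAtMost_iff ceiling_le_iff le_floor_iff by blast
  qed
  then have "finite (int ` ?A)" by (rule finite_subset) simp
  then have fin: "finite ?A" by (rule finite_imageD) auto
  have "card ?A = card (int ` ?A)" by (simp add: card_image)
  also have "\<dots> \<le> nat (\<lfloor>real u + d\<rfloor> + 1 - \<lceil>real u - d\<rceil>)"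
    using card_mono[OF _ sub] by simp
  finally have card: "real (card ?A) \<le> 2 * d + 1" using d by linarith
  have "measure (poisson_pmf r) ?A = sum (pmf (poisson_pmf r)) ?A"
    using fin by (rule measure_measure_pmf_finite)
  also have "\<dots> \<le> (\<Sum>v\<in>?A. exp 1 / sqrt r)" using pmf_poisson_le[OF r] by (intro sum_mono)
  also have "\<dots> = real (card ?A) * (exp 1 / sqrt r)" by simp
  also have "\<dots> \<le> (2 * d + 1) * (exp 1 / sqrt r)" using card r by (intro mult_right_mono) auto
  finally show ?thesis .
qed

lemma prob_unif_counts_component:
  assumes "finite A" "i \<in> A" "i < m"
  shows "measure (unif_counts m r A) {N. N i \<in> S} = measure (poisson_pmf r) S"
proof -
  have "map_pmf (\<lambda>N. N i) (unif_counts m r A) = poisson_pmf r"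
    using assms by (simp add: Pi_pmf_component)
  then show ?thesis by (metis measure_map_pmf vimage_def)
qed

text \<open>With probability at least 1/2 both counts are within \<open>r / 2\<close> of
  \<open>r\<close>, hence above the threshold, and differ by more than \<open>d\<close>. The weights
  are then empirical frequencies, and their discrepancy is at least
  \<open>(d / (3 * r))\<^sup>2 / 2 = 1 / (4608 * r)\<close>.\<close>

lemma gap_empirical_ge:
  assumes n: "n \<ge> 1" and ij: "i < m" "j < m" "i \<noteq> j" "m \<le> k" and r: "r \<ge> 1000" and y0: "real y0 \<le> r / 2"
  shows "ennreal (1 / (9216 * r)) \<le>
     (\<integral>\<^sup>+N. ennreal (gap (mgt_weight n k y0 N i) (mgt_weight n k y0 N j)) \<partial>measure_pmf (unif_counts m r {..<k}))"
proof -
  let ?L = "unif_counts m r {..<k}" and ?P = "poisson_pmf r"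
  \<comment> \<open>Small enough that the two counts come within \<open>d\<close> of each other with
    probability at most \<open>exp 1 * (1 / 8 + 1 / sqrt r)\<close>, which is below 1/2.\<close>
  define d where "d = sqrt r / 16"
  define close where "close = {N :: nat \<Rightarrow> nat. \<bar>real (N i) - real (N j)\<bar> \<le> d}"
  define far where "far = {y :: nat. r / 2 \<le> \<bar>real y - r\<bar>}"
  define bad where "bad = close \<union> ({N. N i \<in> far} \<union> {N. N j \<in> far})"
  have r0: "r > 0" and d: "d \<ge> 0" using r by (auto simp: d_def)
  have sr: "sqrt r > 30" using r by (intro real_less_rsqrt) simp
  have "emeasure ?L close = (\<integral>\<^sup>+N. indicator close N \<partial>measure_pmf ?L)" by simp
  \<comment> \<open>With all other counts fixed, \<open>N i\<close> has to fall within
    \<open>d\<close> of the fixed number \<open>f j\<close>.\<close>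
  also have "\<dots> = (\<integral>\<^sup>+f. (\<integral>\<^sup>+v. indicator close (f(i := v)) \<partial>measure_pmf ?P) \<partial>measure_pmf (unif_counts m r ({..<k} - {i})))"
    using ij by (intro nn_integral_unif_counts_split) auto
  also have "\<dots> \<le> (\<integral>\<^sup>+f. ennreal ((2 * d + 1) * (exp 1 / sqrt r)) \<partial>measure_pmf (unif_counts m r ({..<k} - {i})))"
  proof (intro nn_integral_mono)
    fix f
    have "(\<integral>\<^sup>+v. indicator close (f(i := v)) \<partial>measure_pmf ?P)
       = (\<integral>\<^sup>+v. indicator {v. \<bar>real v - real (f j)\<bar> \<le> d} v \<partial>measure_pmf ?P)"
      using ij by (intro nn_integral_cong) (auto simp: close_def indicator_def)
    also have "\<dots> = ennreal (measure ?P {v. \<bar>real v - real (f j)\<bar> \<le> d})"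
      by (simp add: measure_pmf.emeasure_eq_measure)
    also have "\<dots> \<le> ennreal ((2 * d + 1) * (exp 1 / sqrt r))"
      using r0 d by (intro ennreal_leI prob_poisson_near_le)
    finally show "(\<integral>\<^sup>+v. indicator close (f(i := v)) \<partial>measure_pmf ?P) \<le> \<dots>" .
  qed
  also have "\<dots> = ennreal ((2 * d + 1) * (exp 1 / sqrt r))" by simp
  finally have "measure ?L close \<le> (2 * d + 1) * (exp 1 / sqrt r)"
    using r0 d by (simp add: measure_pmf.emeasure_eq_measure)
  also have "\<dots> = exp 1 * (1 / 8 + 1 / sqrt r)" using r0 by (simp add: d_def field_simps)
  also have "\<dots> \<le> 2.72 * (1 / 8 + 1 / 30)"
    using sr e_less_272 r0 by (intro mult_mono add_mono order_refl frac_le) auto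
  also have "\<dots> \<le> 431 / 1000" by (simp add: power2_eq_square)
  finally have c: "measure ?L close \<le> 431 / 1000" .
  have far: "measure ?P far \<le> 1 / 250"
  proof -
    have "measure ?P far \<le> r / (r / 2)\<^sup>2" unfolding far_def using r0 by (intro poisson_chebyshev) auto
    also have "\<dots> \<le> 1 / 250" using r by (simp add: power2_eq_square field_simps)
    finally show ?thesis .
  qed
  have fi: "measure ?L {N. N i \<in> far} \<le> 1 / 250" "measure ?L {N. N j \<in> far} \<le> 1 / 250"
    using far ij by (auto simp: prob_unif_counts_component)
  have "measure ?L bad \<le> measure ?L close + (measure ?L {N. N i \<in> far} + measure ?L {N. N j \<in> far})"
    unfolding bad_def by (intro order_trans[OF measure_Un_le] add_mono order_refl) auto
  then have "measure ?L bad \<le> 1 / 2" using c fi by linarith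
  then have good: "1 / 2 \<le> measure ?L (- bad)"
    using measure_pmf.prob_compl[of bad ?L] by (simp add: Compl_eq_Diff_UNIV)
  have "ennreal (1 / (9216 * r)) \<le> ennreal (1 / (4608 * r) * measure ?L (- bad))"
    using mult_left_mono[OF good, of "1 / (4608 * r)"] r0 by (intro ennreal_leI) auto
  also have "\<dots> = (\<integral>\<^sup>+N. ennreal (1 / (4608 * r)) * indicator (- bad) N \<partial>measure_pmf ?L)"
    using r0 by (simp add: nn_integral_cmult_indicator measure_pmf.emeasure_eq_measure flip: ennreal_mult)
  also have "\<dots> \<le> (\<integral>\<^sup>+N. ennreal (gap (mgt_weight n k y0 N i) (mgt_weight n k y0 N j)) \<partial>measure_pmf ?L)"
  proof (intro nn_integral_mono)
    fix N
    have "1 / (4608 * r) \<le> gap (mgt_weight n k y0 N i) (mgt_weight n k y0 N j)" if "N \<in> - bad"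
    proof -
      define a b where "a = real (N i)" and "b = real (N j)"
      have *: "d < \<bar>a - b\<bar>" "\<bar>a - r\<bar> < r / 2" "\<bar>b - r\<bar> < r / 2"
        using that by (auto simp: bad_def close_def far_def a_def b_def)
      have pos: "a > r / 2" "b > r / 2" "a + b < 3 * r" using *(2,3) by arith+
      have "\<not> N i \<le> y0" "\<not> N j \<le> y0" using pos y0 unfolding a_def b_def by linarith+
      then have w: "mgt_weight n k y0 N i = a / real n" "mgt_weight n k y0 N j = b / real n"
        by (auto simp: mgt_weight_def a_def b_def)
      have "1 / (2304 * r) = (d / (3 * r))\<^sup>2"
        using r0 by (simp add: d_def power_divide power2_eq_square)
      also have "\<dots> \<le> (\<bar>a - b\<bar> / (a + b))\<^sup>2"
        using * pos r0 d by (intro power_mono frac_le) auto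
      finally have "1 / (4608 * r) \<le> ((a - b) / (a + b))\<^sup>2 / 2"
        using r0 by (simp add: power_divide)
      also have "\<dots> = gap (mgt_weight n k y0 N i) (mgt_weight n k y0 N j)"
        using n by (simp add: w gap_def flip: add_divide_distrib diff_divide_distrib)
      finally show ?thesis .
    qed
    then show "ennreal (1 / (4608 * r)) * indicator (- bad) N
        \<le> ennreal (gap (mgt_weight n k y0 N i) (mgt_weight n k y0 N j))"
      by (auto simp: indicator_def intro: ennreal_leI)
  qed
  finally show ?thesis .
qed

section \<open>Large thresholds: Good--Turing weights\<close>

lemma profile_fun_upd:
  assumes "l < k"
  shows "profile k (f(l := v)) y = card {x. x < k \<and> x \<noteq> l \<and> f x = y} + (if v = y then 1 else 0)"
proof (cases "v = y")
  case True
  then have "{x. x < k \<and> (f(l := v)) x = y} = insert l {x. x < k \<and> x \<noteq> l \<and> f x = y}"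
    using assms by auto
  then show ?thesis using True by (simp add: profile_def)
next
  case False
  then have "{x. x < k \<and> (f(l := v)) x = y} = {x. x < k \<and> x \<noteq> l \<and> f x = y}" by auto
  then show ?thesis using False by (simp add: profile_def)
qed

text \<open>No \<open>b\<close> is close to both \<open>a\<close> and \<open>2 * a\<close>. The case
  split at \<open>7 / 5 * a\<close> roughly balances the two relative distances, 3/17 and
  1/6.\<close>

lemma gap_factor_two:
  assumes "a > 0" "b > 0"
  shows "1 / 100 \<le> gap a b + gap (2 * a) b"
proof (cases "b \<le> 7 / 5 * a")
  case True
  have "3 / 17 \<le> (2 * a - b) / (2 * a + b)" using True assms by (simp add: field_simps)
  then have "(3 / 17)\<^sup>2 \<le> ((2 * a - b) / (2 * a + b))\<^sup>2" by (intro power_mono) auto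
  then have "1 / 100 \<le> gap (2 * a) b" by (simp add: gap_def power2_eq_square)
  then show ?thesis using gap_nonneg[of a b] by linarith
next
  case False
  have "1 / 6 \<le> (b - a) / (a + b)" using False assms by (simp add: field_simps)
  then have "(1 / 6)\<^sup>2 \<le> ((b - a) / (a + b))\<^sup>2" by (intro power_mono) auto
  also have "\<dots> = ((a - b) / (a + b))\<^sup>2" by (simp add: power_divide power2_commute)
  finally have "1 / 100 \<le> gap a b" by (simp add: gap_def power2_eq_square)
  then show ?thesis using gap_nonneg[of "2 * a" b] by linarith
qed

text \<open>Moving the count of a third symbol \<open>l\<close> from \<open>y\<close> to \<open>y + 2\<close> halves the profile entry that
  divides the weight of \<open>i\<close>, and it does not affect the weight of \<open>j\<close>.\<close>
lemma gap_flip_ge: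
  assumes n: "n \<ge> 1" and lt: "i < k" "j < k" "l < k" and ne: "i \<noteq> j" "l \<noteq> i" "l \<noteq> j"
    and y: "Suc z \<le> y0"
    and fi: "f i = Suc z" and fj: "f j \<notin> {z, Suc z, Suc (Suc z), Suc (Suc (Suc z))}"
    and others: "\<And>x. x < k \<Longrightarrow> x \<noteq> i \<Longrightarrow> x \<noteq> j \<Longrightarrow> x \<noteq> l \<Longrightarrow> f x \<notin> {Suc z, Suc (Suc (Suc z))}"
  shows "1 / 100 \<le> gap (mgt_weight n k y0 (f(l := Suc z)) i) (mgt_weight n k y0 (f(l := Suc z)) j)
     + gap (mgt_weight n k y0 (f(l := Suc (Suc (Suc z)))) i) (mgt_weight n k y0 (f(l := Suc (Suc (Suc z)))) j)"
proof -
  let ?f = "f(l := Suc z)" and ?g = "f(l := Suc (Suc (Suc z)))"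
  define q where "q = card {x. x < k \<and> x \<noteq> l \<and> f x = Suc (Suc z)}"
  have "{x. x < k \<and> x \<noteq> l \<and> f x = Suc z} = {i}"
    using lt ne fi fj others by auto
  then have p: "profile k ?f (Suc z) = 2" "profile k ?g (Suc z) = 1"
    using lt by (auto simp: profile_fun_upd)
  \<comment> \<open>The alternative level lies two above \<open>Suc z\<close>, not one, so that the
    profile in the numerator of the weight of \<open>i\<close> stays the same.\<close>
  have q: "profile k ?f (Suc (Suc z)) = q" "profile k ?g (Suc (Suc z)) = q"
    using lt by (auto simp: profile_fun_upd q_def)
  define a where "a = mgt_weight n k y0 ?f i"
  have a: "mgt_weight n k y0 ?g i = 2 * a"
    using ne fi y p q by (simp add: a_def mgt_weight_def)
  have same: "profile k ?f v = profile k ?g v" if "v \<noteq> Suc z" "v \<noteq> Suc (Suc (Suc z))" for v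
    using lt that by (simp add: profile_fun_upd)
  \<comment> \<open>The weight of \<open>j\<close> reads the profile at \<open>f j\<close> and
    \<open>Suc (f j)\<close>. Only the levels \<open>Suc z\<close> and \<open>z + 3\<close> change,
    and excluding \<open>z\<close> to \<open>z + 3\<close> for \<open>f j\<close> keeps both
    arguments off them.\<close>
  have b: "mgt_weight n k y0 ?g j = mgt_weight n k y0 ?f j"
    using ne fj same[of "f j"] same[of "Suc (f j)"] by (simp add: mgt_weight_def)
  show ?thesis unfolding a b a_def[symmetric]
    by (intro gap_factor_two) (use mgt_weight_pos[OF n] lt a_def in auto)
qed

text \<open>Between \<open>r\<close> and \<open>2 * r\<close> successive masses have ratio between
  1/2 and 1, so the four masses from \<open>z\<close> on are all of order \<open>1 / real m\<close>.
  One symbol therefore avoids the two levels with probability at least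
  \<open>1 - 8 / real m\<close>, and \<open>m\<close> independent symbols avoid them with
  probability bounded below.\<close>

lemma poisson_level_window:
  assumes m: "real m \<le> r" "r \<le> 2 * real m" and r: "r \<ge> 3000"
  obtains z where
    "2 / real m \<le> pmf (poisson_pmf r) (Suc z)"
    "1 / (2 * real m) \<le> pmf (poisson_pmf r) (Suc (Suc (Suc z)))"
    "pmf (poisson_pmf r) (Suc (Suc (Suc z))) \<le> pmf (poisson_pmf r) (Suc z)"
    "1 / 2 \<le> measure (poisson_pmf r) (- {z, Suc z, Suc (Suc z), Suc (Suc (Suc z))})"
    "exp (- 16) \<le> measure (poisson_pmf r) (- {Suc z, Suc (Suc (Suc z))}) ^ m"
    "real z + 3 \<le> 2 * r"
proof -
  let ?P = "pmf (poisson_pmf r)"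
  have r0: "r > 0" and m0: "real m \<ge> 1500" using r m by linarith+
  obtain z where z: "?P z > 4 / real m" "?P (Suc z) \<le> 4 / real m" "r < real (Suc z)" "real z + 3 \<le> 2 * r"
    using m r by (rule poisson_level)
  define u where "u = 1 / real m"
  have u: "0 < u" "u \<le> 1 / 1500" using m0 by (auto simp: u_def field_simps)
  have ratio: "?P v / 2 \<le> ?P (Suc v) \<and> ?P (Suc v) \<le> ?P v" if "r < real (Suc v)" "real (Suc v) \<le> 2 * r" for v
  proof
    have "?P v * (1 / 2) \<le> ?P v * (r / real (Suc v))"
      using that r0 by (intro mult_left_mono pmf_nonneg) (simp add: field_simps)
    then show "?P v / 2 \<le> ?P (Suc v)" unfolding pmf_poisson_Suc[OF r0, of v] by simp
    have "?P v * (r / real (Suc v)) \<le> ?P v * 1"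
      using that r0 by (intro mult_left_mono pmf_nonneg) simp
    then show "?P (Suc v) \<le> ?P v" unfolding pmf_poisson_Suc[OF r0, of v] by simp
  qed
  define a b c d where "a = ?P z" and "b = ?P (Suc z)" and "c = ?P (Suc (Suc z))" and "d = ?P (Suc (Suc (Suc z)))"
  have "4 * u < a" "b \<le> 4 * u" using z by (simp_all add: a_def b_def u_def del: pmf_poisson)
  moreover have "a / 2 \<le> b" using ratio[of z] z unfolding a_def b_def by simp
  moreover have "b / 2 \<le> c \<and> c \<le> b" using ratio[of "Suc z"] z unfolding b_def c_def by simp
  moreover have "c / 2 \<le> d \<and> d \<le> c" using ratio[of "Suc (Suc z)"] z unfolding c_def d_def by simp
  ultimately have P: "2 * u \<le> b" "u / 2 \<le> d" "d \<le> b" "b + d \<le> 8 * u" "a + b + c + d \<le> 20 * u"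
    by linarith+
  let ?J = "{z, Suc z, Suc (Suc z), Suc (Suc (Suc z))}" and ?Y = "{Suc z, Suc (Suc (Suc z))}"
  have compl: "measure (poisson_pmf r) (- S) = 1 - measure (poisson_pmf r) S" for S
    using measure_pmf.prob_compl[of S "poisson_pmf r"] by (simp add: Compl_eq_Diff_UNIV)
  have "measure (poisson_pmf r) ?J = a + b + c + d"
    by (simp add: a_def b_def c_def d_def measure_measure_pmf_finite del: pmf_poisson)
  then have J: "1 / 2 \<le> measure (poisson_pmf r) (- ?J)"
    unfolding compl using P(5) u by linarith
  have "measure (poisson_pmf r) ?Y = b + d"
    by (simp add: b_def d_def measure_measure_pmf_finite del: pmf_poisson)
  then have Y: "1 - 8 * u \<le> measure (poisson_pmf r) (- ?Y)"
    unfolding compl using P(4) by linarith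
  \<comment> \<open>The inequality \<open>exp (- (2 * t)) \<le> 1 - t\<close>, valid for
    \<open>t \<le> 1 / 2\<close>, is used at \<open>t = 8 * u\<close>; the \<open>m\<close>-th power
    then gives \<open>exp (- 16)\<close>.\<close>
  have "exp (- (16 * u)) \<le> 1 - 8 * u"
  proof -
    define t where "t = 8 * u"
    have t: "0 \<le> t" "t \<le> 1 / 2" using u by (auto simp: t_def)
    have "1 \<le> (1 - t) * (1 + 2 * t)" using t mult_nonneg_nonneg[of t "1 - 2 * t"] by (simp add: algebra_simps)
    also have "\<dots> \<le> (1 - t) * exp (2 * t)" using t exp_ge_add_one_self by (intro mult_left_mono) auto
    finally have "exp (- (2 * t)) \<le> 1 - t" by (simp add: exp_minus field_simps)
    then show ?thesis by (simp add: t_def)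
  qed
  then have "exp (- (16 * u)) ^ m \<le> measure (poisson_pmf r) (- ?Y) ^ m"
    using Y by (intro power_mono) auto
  moreover have "exp (- (16 * u)) ^ m = exp (- 16)"
    using m0 by (simp add: exp_of_nat_mult[symmetric] u_def)
  ultimately have "exp (- 16) \<le> measure (poisson_pmf r) (- ?Y) ^ m" by simp
  then show thesis using that[of z] P(1-3) J z(4) unfolding b_def d_def u_def by simp
qed

text \<open>The event contains a product event. Symbols from \<open>m\<close> on have count 0, which
  is not in \<open>Y\<close>, and contribute a factor 1; at most \<open>m\<close> others contribute
  \<open>P (- Y)\<close>.\<close>

lemma prob_one_two_rest_ge:
  fixes r :: real
  assumes ij: "i < m" "j < m" "i \<noteq> j" and l: "l \<noteq> i" "l \<noteq> j" and mk: "m \<le> k" and y: "0 \<notin> Y"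
  defines "P \<equiv> measure (poisson_pmf r)"
  shows "P S * (P T * P (- Y) ^ m) \<le> measure (unif_counts m r ({..<k} - {l}))
     {f. f i \<in> S \<and> f j \<in> T \<and> (\<forall>x<k. x \<noteq> i \<longrightarrow> x \<noteq> j \<longrightarrow> x \<noteq> l \<longrightarrow> f x \<notin> Y)}"
proof -
  define B where "B x = (if x = i then S else if x = j then T else - Y)" for x
  define q where "q = P (- Y)"
  have q: "0 \<le> q" "q \<le> 1" by (simp_all add: q_def P_def)
  let ?F = "\<lambda>x. if x < m then poisson_pmf r else return_pmf 0"
  define A where "A = {..<k} - {l} - {i} - {j}"
  have A: "{..<k} - {l} = insert i (insert j A)" "i \<notin> insert j A" "j \<notin> A" "finite A"
    using ij l mk by (auto simp: A_def)
  have B: "B i = S" "B j = T" "\<And>x. x \<in> A \<Longrightarrow> B x = - Y"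
    using ij by (auto simp: B_def A_def)
  have "q ^ m \<le> q ^ card (A \<inter> {..<m})"
    using q card_mono[of "{..<m}" "A \<inter> {..<m}"] by (intro power_decreasing) auto
  also have "\<dots> = (\<Prod>x\<in>A \<inter> {..<m}. q)" by simp
  also have "\<dots> = (\<Prod>x\<in>A. if x < m then q else 1)"
    using A(4) by (intro prod.mono_neutral_cong_left) auto
  also have "\<dots> = (\<Prod>x\<in>A. measure (?F x) (B x))"
    using B(3) y by (intro prod.cong refl) (simp add: q_def P_def indicator_def)
  finally have "q ^ m \<le> (\<Prod>x\<in>A. measure (?F x) (B x))" .
  then have "P S * (P T * q ^ m) \<le> P S * (P T * (\<Prod>x\<in>A. measure (?F x) (B x)))"
    by (intro mult_left_mono) (auto simp: P_def)
  also have "\<dots> = (\<Prod>x\<in>{..<k} - {l}. measure (?F x) (B x))"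
    unfolding A(1) using A(2-4) ij B(1,2) by (simp add: P_def)
  also have "\<dots> = measure (unif_counts m r ({..<k} - {l})) (Pi ({..<k} - {l}) B)"
    by (intro measure_Pi_pmf_Pi[symmetric]) auto
  also have "\<dots> \<le> measure (unif_counts m r ({..<k} - {l}))
     {f. f i \<in> S \<and> f j \<in> T \<and> (\<forall>x<k. x \<noteq> i \<longrightarrow> x \<noteq> j \<longrightarrow> x \<noteq> l \<longrightarrow> f x \<notin> Y)}"
  proof (intro measure_pmf.finite_measure_mono subsetI CollectI conjI allI impI)
    fix f assume f: "f \<in> Pi ({..<k} - {l}) B"
    have fB: "f x \<in> B x" if "x \<in> insert i (insert j A)" for x
      using f that unfolding A(1) by (rule Pi_mem)
    show "f i \<in> S" using fB[of i] B by simp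
    show "f j \<in> T" using fB[of j] B by simp
    fix x assume "x < k" "x \<noteq> i" "x \<noteq> j" "x \<noteq> l"
    then have "x \<in> A" by (simp add: A_def)
    then show "f x \<notin> Y" using fB[of x] B by simp
  qed simp
  finally show ?thesis by (simp add: q_def)
qed

text \<open>For each third symbol \<open>l\<close>, the event \<open>R l\<close> has probability of
  order \<open>1 / m\<close>. On it, the two values \<open>y\<close> and \<open>y'\<close> of the
  count of \<open>l\<close>, each of mass at least \<open>1 / (2 * real m)\<close>, have
  discrepancies adding up to at least 1/100. The events for different \<open>l\<close> are disjoint,
  and summing over the roughly \<open>m\<close> choices of \<open>l\<close> leaves order
  \<open>1 / m\<close>.\<close>

lemma gap_turing_ge:
  assumes n: "n \<ge> 1" and ij: "i < m" "j < m" "i \<noteq> j" "m \<le> k"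
    and m: "real m \<le> r" "r \<le> 2 * real m" and r: "r \<ge> 3000" and y0: "2 * r \<le> real y0"
  shows "ennreal (exp (- 16) / (400 * real m)) \<le>
     (\<integral>\<^sup>+N. ennreal (gap (mgt_weight n k y0 N i) (mgt_weight n k y0 N j)) \<partial>measure_pmf (unif_counts m r {..<k}))"
proof -
  let ?L = "unif_counts m r {..<k}" and ?P = "pmf (poisson_pmf r)"
  let ?w = "mgt_weight n k y0"
  have m0: "real m \<ge> 1500" using r m by linarith
  obtain z where z: "2 / real m \<le> ?P (Suc z)" "1 / (2 * real m) \<le> ?P (Suc (Suc (Suc z)))"
      "?P (Suc (Suc (Suc z))) \<le> ?P (Suc z)"
    and J: "1 / 2 \<le> measure (poisson_pmf r) (- {z, Suc z, Suc (Suc z), Suc (Suc (Suc z))})"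
    and Y: "exp (- 16) \<le> measure (poisson_pmf r) (- {Suc z, Suc (Suc (Suc z))}) ^ m"
    and zr: "real z + 3 \<le> 2 * r"
    using m r by (rule poisson_level_window)
  define y y' J where "y = Suc z" and "y' = Suc (Suc (Suc z))" and "J = {z, Suc z, Suc (Suc z), Suc (Suc (Suc z))}"
  note Py = z(1)[folded y_def] and Py' = z(2,3)[folded y'_def y_def]
    and J = J[folded J_def] and Y = Y[folded y'_def y_def]
  have yy': "y \<noteq> y'" by (simp add: y_def y'_def)
  \<comment> \<open>The condition leaves the count of \<open>l\<close> free, so it survives changing
    that count.\<close>
  define R where "R l = {f. f i = y \<and> f j \<notin> J \<and> (\<forall>x<k. x \<noteq> i \<longrightarrow> x \<noteq> j \<longrightarrow> x \<noteq> l \<longrightarrow> f x \<notin> {y, y'})}"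
    for l :: nat
  define D where "D = {..<m} - {i, j}"
  define h where "h N = ennreal (gap (?w N i) (?w N j))" for N
  have prob_R: "exp (- 16) / real m \<le> measure (unif_counts m r ({..<k} - {l})) (R l)" if l: "l \<in> D" for l
  proof -
    let ?Q = "measure (poisson_pmf r)"
    have "exp (- 16) / real m = 2 / real m * (1 / 2 * exp (- 16))" by simp
    also have "\<dots> \<le> ?Q {y} * (?Q (- J) * ?Q (- {y, y'}) ^ m)"
      using Py J Y unfolding measure_pmf_single by (intro mult_mono) (auto simp del: pmf_poisson)
    also have "\<dots> \<le> measure (unif_counts m r ({..<k} - {l})) (R l)"
      using prob_one_two_rest_ge[of i m j l k "{y, y'}" r "{y}" "- J"] ij l
      by (simp add: R_def D_def y_def y'_def)
    finally show ?thesis .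
  qed
  have part: "ennreal (exp (- 16) / (200 * (real m)\<^sup>2)) \<le>
      (\<integral>\<^sup>+N. h N * indicator {N. N \<in> R l \<and> N l \<in> {y, y'}} N \<partial>measure_pmf ?L)" if l: "l \<in> D" for l
  proof -
    let ?R = "measure_pmf (unif_counts m r ({..<k} - {l}))"
    have lk: "l < k" "l < m" "l \<noteq> i" "l \<noteq> j" using l ij by (auto simp: D_def)
    have "ennreal (exp (- 16) / (200 * (real m)\<^sup>2)) = ennreal (1 / (200 * real m) * (exp (- 16) / real m))"
      by (simp add: power2_eq_square)
    also have "\<dots> \<le> ennreal (1 / (200 * real m) * measure ?R (R l))"
      using prob_R[OF l] by (intro ennreal_leI mult_left_mono) auto
    also have "\<dots> = (\<integral>\<^sup>+f. ennreal (1 / (200 * real m)) * indicator (R l) f \<partial>?R)"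
      by (simp add: nn_integral_cmult_indicator measure_pmf.emeasure_eq_measure flip: ennreal_mult)
    also have "\<dots> \<le> (\<integral>\<^sup>+f. (\<integral>\<^sup>+v. h (f(l := v)) * indicator {N. N \<in> R l \<and> N l \<in> {y, y'}} (f(l := v))
         \<partial>measure_pmf (poisson_pmf r)) \<partial>?R)"
    proof (intro nn_integral_mono)
      fix f
      let ?I = "\<lambda>v. h (f(l := v)) * indicator {N. N \<in> R l \<and> N l \<in> {y, y'}} (f(l := v))"
      show "ennreal (1 / (200 * real m)) * indicator (R l) f \<le> (\<integral>\<^sup>+v. ?I v \<partial>measure_pmf (poisson_pmf r))"
      proof (cases "f \<in> R l")
        case False
        then show ?thesis by simp
      next
        case True
        then have upd: "f(l := v) \<in> R l" for v using lk by (auto simp: R_def)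
        define g where "g v = gap (?w (f(l := v)) i) (?w (f(l := v)) j)" for v
        have "1 / 100 \<le> g y + g y'"
          unfolding g_def y_def y'_def
        proof (rule gap_flip_ge)
          show "Suc z \<le> y0" using zr y0 by linarith
          show "f i = Suc z" "f j \<notin> {z, Suc z, Suc (Suc z), Suc (Suc (Suc z))}"
            using True unfolding R_def J_def y_def by blast+
          show "f x \<notin> {Suc z, Suc (Suc (Suc z))}" if "x < k" "x \<noteq> i" "x \<noteq> j" "x \<noteq> l" for x
            using True that unfolding R_def y_def y'_def by blast
        qed (use n ij lk in auto)
        \<comment> \<open>Both alternatives are weighted by the smaller mass, that of
          \<open>y'\<close>, since only the sum of their discrepancies is bounded below.\<close>
        then have "1 / (2 * real m) * (1 / 100) \<le> ?P y' * (g y + g y')"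
          using Py' by (intro mult_mono) (auto simp del: pmf_poisson)
        also have "\<dots> \<le> ?P y * g y + ?P y' * g y'"
          using Py' mult_right_mono[of "?P y'" "?P y" "g y"] by (simp add: g_def gap_nonneg distrib_left del: pmf_poisson)
        finally have "ennreal (1 / (200 * real m)) \<le> ennreal (?P y * g y + ?P y' * g y')"
          by (intro ennreal_leI) simp
        also have "\<dots> = (\<Sum>v\<in>{y, y'}. ennreal (g v) * ennreal (?P v))"
          using yy' by (simp add: g_def gap_nonneg mult.commute ennreal_mult del: pmf_poisson)
        also have "\<dots> = (\<integral>\<^sup>+v. ?I v \<partial>measure_pmf (poisson_pmf r))"
          by (subst nn_integral_measure_pmf_support[of "{y, y'}"])
            (use upd in \<open>auto simp: h_def g_def simp del: pmf_poisson\<close>)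
        finally show ?thesis using True by simp
      qed
    qed
    also have "\<dots> = (\<integral>\<^sup>+N. h N * indicator {N. N \<in> R l \<and> N l \<in> {y, y'}} N \<partial>measure_pmf ?L)"
      using lk by (intro nn_integral_unif_counts_split[symmetric]) auto
    finally show ?thesis .
  qed
  have "card D = m - 2" unfolding D_def using ij by (subst card_Diff_subset) auto
  then have D: "real (card D) \<ge> real m / 2" using m0 by linarith
  have "exp (- 16) / (400 * real m) = real m / 2 * (exp (- 16) / (200 * (real m)\<^sup>2))"
    using m0 by (simp add: power2_eq_square)
  also have "\<dots> \<le> real (card D) * (exp (- 16) / (200 * (real m)\<^sup>2))"
    using D by (intro mult_right_mono) auto
  finally have "ennreal (exp (- 16) / (400 * real m)) \<le> ennreal (real (card D) * (exp (- 16) / (200 * (real m)\<^sup>2)))"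
    by (rule ennreal_leI)
  also have "\<dots> = (\<Sum>l\<in>D. ennreal (exp (- 16) / (200 * (real m)\<^sup>2)))"
    by (subst sum_ennreal) auto
  also have "\<dots> \<le> (\<Sum>l\<in>D. \<integral>\<^sup>+N. h N * indicator {N. N \<in> R l \<and> N l \<in> {y, y'}} N \<partial>measure_pmf ?L)"
    using part by (intro sum_mono)
  also have "\<dots> = (\<integral>\<^sup>+N. (\<Sum>l\<in>D. h N * indicator {N. N \<in> R l \<and> N l \<in> {y, y'}} N) \<partial>measure_pmf ?L)"
    by (simp add: nn_integral_sum)
  also have "\<dots> \<le> (\<integral>\<^sup>+N. h N \<partial>measure_pmf ?L)"
  proof (intro nn_integral_mono)
    fix N
    show "(\<Sum>l\<in>D. h N * indicator {N. N \<in> R l \<and> N l \<in> {y, y'}} N) \<le> h N"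
    proof (cases "\<exists>l\<in>D. N \<in> R l \<and> N l \<in> {y, y'}")
      case True
      then obtain l where l: "l \<in> D" "N \<in> R l" "N l \<in> {y, y'}" by blast
      \<comment> \<open>\<open>R l\<close> keeps every symbol of \<open>D\<close> other than
        \<open>l\<close> off the levels \<open>y\<close> and \<open>y'\<close>, so at most one
        summand is nonzero.\<close>
      have "(\<Sum>l\<in>D. h N * indicator {N. N \<in> R l \<and> N l \<in> {y, y'}} N)
          = (\<Sum>x\<in>{l}. h N * indicator {N. N \<in> R x \<and> N x \<in> {y, y'}} N)"
      proof (intro sum.mono_neutral_right ballI)
        fix x assume x: "x \<in> D - {l}"
        then have "N x \<notin> {y, y'}" using l(2) ij unfolding R_def D_def by auto
        then show "h N * indicator {N. N \<in> R x \<and> N x \<in> {y, y'}} N = 0" by simp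
      qed (use l in \<open>auto simp: D_def\<close>)
      also have "\<dots> = h N" using l by (subst sum.insert) auto
      finally show ?thesis by simp
    next
      case False
      then have "(\<Sum>l\<in>D. h N * indicator {N. N \<in> R l \<and> N l \<in> {y, y'}} N) = 0"
        by (intro sum.neutral) auto
      then show ?thesis by simp
    qed
  qed
  finally show ?thesis by (simp add: h_def)
qed

section \<open>The regret bound\<close>

lemma gap_commute: "gap a b = gap b a"
  by (simp add: gap_def power_divide power2_commute add.commute)

text \<open>The ratio 4/3 is the worst case in \<open>gap_one_two_ge\<close>: two symbols and both
  weights of Good--Turing form, namely \<open>4 / real n\<close> and
  \<open>3 / real n\<close>.\<close>

lemma gap_ratio_ge:
  assumes "0 < a" "0 < b" "4 * a \<le> 3 * b"
  shows "1 / 100 \<le> gap a b"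
proof -
  have "1 / 7 \<le> (b - a) / (a + b)" using assms by (simp add: field_simps)
  then have "(1 / 7)\<^sup>2 \<le> ((b - a) / (a + b))\<^sup>2" by (intro power_mono) auto
  also have "\<dots> = ((a - b) / (a + b))\<^sup>2" by (simp add: power_divide power2_commute)
  finally show ?thesis by (simp add: gap_def power2_eq_square)
qed

text \<open>The configuration with count 1 at \<open>i\<close> and count 2 at every other symbol is never given
  uniform weights, whatever the threshold.\<close>
lemma gap_one_two_ge:
  assumes n: "n \<ge> 1" and ij: "i < k" "j < k" "i \<noteq> j" and r: "r > 0"
  shows "ennreal (pmf (poisson_pmf r) 1 * pmf (poisson_pmf r) 2 ^ (k - 1) / 100) \<le>
     (\<integral>\<^sup>+N. ennreal (gap (mgt_weight n k y0 N i) (mgt_weight n k y0 N j)) \<partial>measure_pmf (unif_counts k r {..<k}))"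
proof -
  let ?L = "unif_counts k r {..<k}"
  define M where "M x = (if x = i then 1 else if x < k then 2 else 0::nat)" for x
  have "{x. x < k \<and> M x = 1} = {i}" "{x. x < k \<and> M x = 2} = {..<k} - {i}" "{x. x < k \<and> M x = 3} = {}"
    using ij by (auto simp: M_def split: if_splits)
  then have prof: "profile k M (Suc 0) = 1" "profile k M 2 = k - 1" "profile k M 3 = 0"
    using ij by (auto simp: profile_def)
  have k: "real k \<ge> 2" using ij by linarith
  have Mij: "M i = Suc 0" "M j = 2" using ij by (auto simp: M_def)
  have n0: "real n > 0" using n by simp
  have gapM: "1 / 100 \<le> gap (mgt_weight n k y0 M i) (mgt_weight n k y0 M j)"
  proof -
    \<comment> \<open>Both weights are empirical, only that of \<open>i\<close> is Good--Turing, or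
      both are; the larger one belongs to \<open>j\<close> in the first case and to \<open>i\<close>
      in the others.\<close>
    consider "y0 = 0" | "y0 = 1" | "y0 \<ge> 2" by linarith
    then show ?thesis
    proof cases
      case 1
      then have "mgt_weight n k y0 M i = 1 / real n" "mgt_weight n k y0 M j = 2 / real n"
        using Mij by (simp_all add: mgt_weight_def)
      then show ?thesis using n0 by (intro gap_ratio_ge) (auto simp: divide_le_cancel)
    next
      case 2
      then have w: "mgt_weight n k y0 M i = 2 * real k / real n" "mgt_weight n k y0 M j = 2 / real n"
        using Mij prof k by (simp_all add: mgt_weight_def of_nat_diff numeral_2_eq_2)
      show ?thesis unfolding w gap_commute[of "2 * real k / real n"]
        using n0 k by (intro gap_ratio_ge) (auto simp: field_simps)
    next
      case 3
      have w1: "mgt_weight n k y0 M i = 2 * real k / real n"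
        using 3 Mij prof k by (simp add: mgt_weight_def of_nat_diff numeral_2_eq_2)
      have w2: "mgt_weight n k y0 M j = 3 / (real n * (real k - 1))"
        using 3 Mij prof k by (simp add: mgt_weight_def of_nat_diff)
      have "2 * 1 \<le> real k * (real k - 1)" using k by (intro mult_mono) auto
      then have "2 / (real k - 1) \<le> real k" using k by (simp add: field_simps)
      then have "6 / real n * (2 / (real k - 1)) \<le> 6 / real n * real k" by (intro mult_left_mono) auto
      then have "4 * (3 / (real n * (real k - 1))) \<le> 3 * (2 * real k / real n)" by simp
      then show ?thesis unfolding w1 w2 gap_commute[of "2 * real k / real n"]
        using n0 k by (intro gap_ratio_ge) auto
    qed
  qed
  have "pmf ?L M = (\<Prod>x\<in>{..<k}. pmf (if x < k then poisson_pmf r else return_pmf 0) (M x))"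
    using ij by (intro pmf_Pi') (auto simp: M_def)
  also have "\<dots> = (\<Prod>x\<in>insert i ({..<k} - {i}). pmf (poisson_pmf r) (M x))"
    using ij by (intro prod.cong) auto
  also have "\<dots> = pmf (poisson_pmf r) 1 * (\<Prod>x\<in>{..<k} - {i}. pmf (poisson_pmf r) 2)"
    by (subst prod.insert) (auto simp: M_def simp del: pmf_poisson intro!: prod.cong)
  also have "\<dots> = pmf (poisson_pmf r) 1 * pmf (poisson_pmf r) 2 ^ (k - 1)"
    using ij by (simp del: pmf_poisson)
  finally have pM: "pmf ?L M = \<dots>" .
  have "ennreal (pmf ?L M / 100) \<le> ennreal (gap (mgt_weight n k y0 M i) (mgt_weight n k y0 M j) * pmf ?L M)"
    using mult_right_mono[OF gapM, of "pmf ?L M"] by (intro ennreal_leI) (simp add: pmf_nonneg)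
  also have "\<dots> = (\<integral>\<^sup>+N. ennreal (gap (mgt_weight n k y0 M i) (mgt_weight n k y0 M j)) * indicator {M} N \<partial>measure_pmf ?L)"
    by (simp add: nn_integral_cmult_indicator emeasure_pmf_single ennreal_mult gap_nonneg)
  also have "\<dots> \<le> (\<integral>\<^sup>+N. ennreal (gap (mgt_weight n k y0 N i) (mgt_weight n k y0 N j)) \<partial>measure_pmf ?L)"
    by (intro nn_integral_mono) (auto simp: indicator_def)
  finally show ?thesis unfolding pM .
qed

section \<open>Assembling the regret bound\<close>

lemma regret_MGT_ge:
  assumes n: "n \<ge> 1" and m: "m \<ge> 2" "m \<le> k" and k: "real k \<le> real n powr C" and a: "a \<ge> 0"
    and pair: "\<And>i j. i < m \<Longrightarrow> j < m \<Longrightarrow> i \<noteq> j \<Longrightarrow> ennreal a \<le>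
      (\<integral>\<^sup>+N. ennreal (gap (mgt_weight n k y0 N i) (mgt_weight n k y0 N j))
         \<partial>measure_pmf (unif_counts m (real n / real m) {..<k}))"
    and mn: "real m \<le> sqrt (real n)"
    and c: "c \<le> a / 2 - (1 / real n + exp (- sqrt (real n)) * ((C + 1) * ln (real n)))"
  shows "ereal c \<le> regret n k (MGT n k y0)"
proof (rule regret_ge)
  \<comment> \<open>With this choice the leaked mass costs at most \<open>1 / real n\<close>, while
    \<open>ln (1 / ?\<epsilon>)\<close> stays logarithmic because \<open>k\<close> is polynomial in
    \<open>n\<close>.\<close>
  let ?\<epsilon> = "1 / (real k * real n)"
  have n0: "real n > 0" and k0: "real k \<ge> 1" and m0: "real m > 0" using n m by auto
  have kn: "real k * real n \<ge> 1" using n k0 mult_mono[of 1 "real k" 1 "real n"] by simp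
  show "unif m \<in> prob_simplex k" using m by (intro unif_in_prob_simplex) auto
  show "ennreal (a / 2) \<le> risk n k (unif m) (MGT n k y0)"
    using n m a pair by (intro risk_MGT_ge) (auto simp: count_law_unif)
  have lnk: "ln (real k * real n) \<le> (C + 1) * ln (real n)"
  proof -
    have "ln (real k) \<le> ln (real n powr C)" using k k0 by (subst ln_le_cancel_iff) (use n0 in auto)
    then show ?thesis using k0 n0 by (simp add: ln_mult ln_powr algebra_simps)
  qed
  have "oracle_risk n k (unif m) \<le> ennreal (?\<epsilon> * real k / real m + exp (- (real n / real m)) * ln (1 / ?\<epsilon>))"
    using n m kn by (intro oracle_risk_unif_le) auto
  also have "\<dots> \<le> ennreal (1 / real n + exp (- sqrt (real n)) * ((C + 1) * ln (real n)))"
  proof (intro ennreal_leI add_mono mult_mono)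
    show "?\<epsilon> * real k / real m \<le> 1 / real n" using n0 k0 m by (simp add: field_simps)
    have "real m * sqrt (real n) \<le> sqrt (real n) * sqrt (real n)" using mn by (intro mult_right_mono) auto
    then show "exp (- (real n / real m)) \<le> exp (- sqrt (real n))" using m0 by (simp add: field_simps)
    show "ln (1 / ?\<epsilon>) \<le> (C + 1) * ln (real n)" using lnk by simp
    show "0 \<le> ln (1 / ?\<epsilon>)" using kn by simp
  qed simp
  finally show "oracle_risk n k (unif m) \<le> ennreal (1 / real n + exp (- sqrt (real n)) * ((C + 1) * ln (real n)))" .
  have "0 \<le> ln (real k * real n)" using kn by simp
  then have "0 \<le> (C + 1) * ln (real n)" using lnk by linarith
  then show "0 \<le> 1 / real n + exp (- sqrt (real n)) * ((C + 1) * ln (real n))" by simp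
qed (use a c in auto)

text \<open>The constant \<open>exp (- 16) / 10 ^ 6\<close> lies below what either threshold regime
  provides: \<open>exp (- 16) / 400\<close> for large thresholds and \<open>1 / (9216 * 32)\<close>
  for small ones.\<close>

lemma regret_MGT_ge_large:
  assumes s: "sqrt (real n) \<ge> 10000" and k: "sqrt (real n) \<le> real k" "real k \<le> real n powr C"
    and c: "c \<le> exp (- 16) / 10 ^ 6 / sqrt (real n) / 2
                 - (1 / real n + exp (- sqrt (real n)) * ((C + 1) * ln (real n)))"
  shows "ereal c \<le> regret n k (MGT n k y0)"
proof -
  define s where "s = sqrt (real n)"
  have s1: "s \<ge> 10000" and ss: "s * s = real n" using s by (auto simp: s_def)
  have "real n > 0" using s1 ss mult_pos_pos[of s s] by simp
  then have n: "n \<ge> 1" by simp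
  have a0: "0 \<le> exp (- 16) / 10 ^ 6 / sqrt (real n)" by simp
  show ?thesis
  proof (cases "real y0 \<ge> 4 * s")
    case True
    \<comment> \<open>This makes \<open>r\<close> and \<open>m\<close> comparable, and
      \<open>r \<le> 2 * s\<close> gives \<open>2 * r \<le> real y0\<close>.\<close>
    define m where "m = nat \<lfloor>s\<rfloor>"
    have m: "real m \<le> s" "s - 1 \<le> real m" using s1 unfolding m_def by linarith+
    have m0: "real m > 0" using m s1 by linarith
    define r where "r = real n / real m"
    have r: "s \<le> r" "r \<le> 2 * real m" "r \<le> 2 * s"
    proof -
      have "s * real m \<le> s * s" using m s1 by (intro mult_left_mono) auto
      then show "s \<le> r" unfolding r_def ss using m0 by (simp add: field_simps)
      have "s * s \<le> 2 * real m * real m"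
      proof -
        have "s * 10000 \<le> s * s" using s1 by (intro mult_left_mono) auto
        moreover have "(s - 1) * (s - 1) \<le> real m * real m" using m s1 by (intro mult_mono) auto
        moreover have "(s - 1) * (s - 1) = s * s - 2 * s + 1" by (simp add: algebra_simps)
        ultimately have "s * s \<le> 2 * (real m * real m)" using s1 by linarith
        then show ?thesis by simp
      qed
      then show "r \<le> 2 * real m" unfolding r_def ss using m0 by (simp add: field_simps)
      then show "r \<le> 2 * s" using m by linarith
    qed
    have "exp (- 16) / 10 ^ 6 / sqrt (real n) \<le> exp (- 16) / (400 * real m)"
      using m m0 s1 by (simp add: s_def[symmetric] field_simps)
    moreover have "ennreal (exp (- 16) / (400 * real m)) \<le>
      (\<integral>\<^sup>+N. ennreal (gap (mgt_weight n k y0 N i) (mgt_weight n k y0 N j)) \<partial>measure_pmf (unif_counts m r {..<k}))"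
      if "i < m" "j < m" "i \<noteq> j" for i j
      using that n m r True k s1 by (intro gap_turing_ge) (auto simp: s_def[symmetric])
    ultimately have pair: "ennreal (exp (- 16) / 10 ^ 6 / sqrt (real n)) \<le>
      (\<integral>\<^sup>+N. ennreal (gap (mgt_weight n k y0 N i) (mgt_weight n k y0 N j))
         \<partial>measure_pmf (unif_counts m (real n / real m) {..<k}))"
      if "i < m" "j < m" "i \<noteq> j" for i j
      using that unfolding r_def by (meson ennreal_leI order_trans)
    have "m \<ge> 2" "real m \<le> sqrt (real n)" using m s1 unfolding s_def by linarith+
    moreover from this have "m \<le> k" using k by linarith
    ultimately show ?thesis using n k(2) a0 pair c by (intro regret_MGT_ge)
  next
    case False
    \<comment> \<open>Now \<open>r \<ge> 16 * s\<close>, so the threshold, below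
      \<open>4 * s\<close>, is less than \<open>r / 2\<close>.\<close>
    define m where "m = nat \<lfloor>s / 16\<rfloor>"
    have m: "real m \<le> s / 16" "s / 16 - 1 \<le> real m" using s1 unfolding m_def by linarith+
    have m0: "real m > 0" using m s1 by linarith
    define r where "r = real n / real m"
    have r: "16 * s \<le> r" "r \<le> 32 * s"
    proof -
      have "s * (real m * 16) \<le> s * s" using m s1 by (intro mult_left_mono) auto
      then show "16 * s \<le> r" unfolding r_def ss[symmetric] using m0 by (simp add: field_simps)
      have "s * s \<le> s * (32 * real m)" using m s1 by (intro mult_left_mono) auto
      then show "r \<le> 32 * s" unfolding r_def ss[symmetric] using m0 by (simp add: field_simps)
    qed
    have "exp (- 16) \<le> (1 :: real)" by simp
    then have "exp (- 16) * (9216 * r) \<le> 1 * (9216 * (32 * s))" using r s1 by (intro mult_mono) auto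
    then have "exp (- 16) * (9216 * r) \<le> 10 ^ 6 * s" using s1 by simp
    then have "exp (- 16) / 10 ^ 6 / sqrt (real n) \<le> 1 / (9216 * r)"
      using r s1 unfolding s_def[symmetric] by (simp add: field_simps)
    moreover have "ennreal (1 / (9216 * r)) \<le>
      (\<integral>\<^sup>+N. ennreal (gap (mgt_weight n k y0 N i) (mgt_weight n k y0 N j)) \<partial>measure_pmf (unif_counts m r {..<k}))"
      if "i < m" "j < m" "i \<noteq> j" for i j
      using that n m r False k s1 by (intro gap_empirical_ge) (auto simp: s_def[symmetric])
    ultimately have pair: "ennreal (exp (- 16) / 10 ^ 6 / sqrt (real n)) \<le>
      (\<integral>\<^sup>+N. ennreal (gap (mgt_weight n k y0 N i) (mgt_weight n k y0 N j))
         \<partial>measure_pmf (unif_counts m (real n / real m) {..<k}))"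
      if "i < m" "j < m" "i \<noteq> j" for i j
      using that unfolding r_def by (meson ennreal_leI order_trans)
    have "m \<ge> 2" "real m \<le> sqrt (real n)" using m s1 unfolding s_def by linarith+
    moreover from this have "m \<le> k" using k by linarith
    ultimately show ?thesis using n k(2) a0 pair c by (intro regret_MGT_ge)
  qed
qed

text \<open>With full support the oracle risk vanishes, so any positive risk is regret; positivity
  is all that is wanted of this bound.\<close>

lemma regret_MGT_ge_small:
  assumes "n \<ge> 1" "k \<ge> 2"
  defines "r \<equiv> real n / real k"
  shows "ereal (pmf (poisson_pmf r) 1 * pmf (poisson_pmf r) 2 ^ (k - 1) / 200) \<le> regret n k (MGT n k y0)"
proof (rule regret_ge)
  have r: "r > 0" using assms by simp
  let ?v = "pmf (poisson_pmf r) 1 * pmf (poisson_pmf r) 2 ^ (k - 1)"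
  have v: "0 \<le> ?v" by (simp add: pmf_nonneg del: pmf_poisson)
  show "unif k \<in> prob_simplex k" using assms by (intro unif_in_prob_simplex) auto
  have "ennreal (?v / 100 / 2) \<le> risk n k (unif k) (MGT n k y0)"
  proof (rule risk_MGT_ge)
    fix i j assume "i < k" "j < k" "i \<noteq> j"
    then show "ennreal (?v / 100) \<le> (\<integral>\<^sup>+N. ennreal (gap (mgt_weight n k y0 N i) (mgt_weight n k y0 N j))
        \<partial>measure_pmf (count_law n k (unif k)))"
      unfolding count_law_unif[OF assms(1)] r_def[symmetric] using assms r by (intro gap_one_two_ge) auto
  qed (use assms v in auto)
  then show "ennreal (?v / 200) \<le> risk n k (unif k) (MGT n k y0)" by simp
  show "oracle_risk n k (unif k) \<le> ennreal 0" using assms by (simp add: oracle_risk_unif_full)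
  show "0 \<le> ?v / 200" using v by simp
qed auto

theorem theorem2:
  fixes C :: real
  assumes "C > 0"
  shows "\<exists>c>0. \<forall>(n::nat) (k::nat) (y0::nat). n \<ge> 1 \<longrightarrow> sqrt (real n) \<le> real k \<longrightarrow> real k \<le> real n powr C \<longrightarrow>
           regret n k (MGT n k y0) \<ge> ereal (c / sqrt (real n * ln (real n)))"
proof -
  \<comment> \<open>Half of the leading constant \<open>exp (- 16) / 10 ^ 6 / 2\<close>; the other
    half absorbs the oracle risk, which is of smaller order than
    \<open>1 / sqrt (real n)\<close>.\<close>
  define c1 :: real where "c1 = exp (- 16) / 10 ^ 6 / 4"
  have c1: "c1 > 0" by (simp add: c1_def)
  have "eventually (\<lambda>n::nat. 1 / real n + exp (- sqrt (real n)) * ((C + 1) * ln (real n)) \<le> c1 / sqrt (real n)) sequentially"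
    using c1 assms by real_asymp
  moreover have "eventually (\<lambda>n::nat. sqrt (real n) \<ge> 10000) sequentially" by real_asymp
  ultimately have "eventually (\<lambda>n::nat. 1 / real n + exp (- sqrt (real n)) * ((C + 1) * ln (real n)) \<le> c1 / sqrt (real n)
      \<and> sqrt (real n) \<ge> 10000) sequentially" by (rule eventually_conj)
  then obtain n0 where n0: "\<And>n. n \<ge> n0 \<Longrightarrow> 1 / real n + exp (- sqrt (real n)) * ((C + 1) * ln (real n)) \<le> c1 / sqrt (real n)"
      "\<And>n. n \<ge> n0 \<Longrightarrow> sqrt (real n) \<ge> 10000"
    by (auto simp: eventually_sequentially)
  define v where "v = (\<lambda>(n, k). pmf (poisson_pmf (real n / real k)) 1 * pmf (poisson_pmf (real n / real k)) 2 ^ (k - 1) / 200)"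
  \<comment> \<open>For \<open>n \<le> n0\<close> the bound \<open>k \<le> n powr C\<close> leaves
    finitely many pairs, and \<open>c\<close> is the minimum of their positive bounds and
    \<open>c1\<close>.\<close>
  define F where "F = {1..n0} \<times> {1..nat \<lfloor>real n0 powr C\<rfloor>}"
  define c where "c = Min (insert c1 (v ` F))"
  have F: "finite F" by (simp add: F_def)
  have "v x > 0" if "x \<in> F" for x using that by (auto simp: v_def F_def)
  then have c0: "c > 0" using F c1 by (auto simp: c_def)
  have cc1: "c \<le> c1" using F by (simp add: c_def)
  have cv: "c \<le> v x" if "x \<in> F" for x using F that by (simp add: c_def)
  have "ereal (c / sqrt (real n * ln (real n))) \<le> regret n k (MGT n k y0)"
    if n: "n \<ge> 1" and k: "sqrt (real n) \<le> real k" "real k \<le> real n powr C" for n k y0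
  proof -
    consider "n = 1" | "n \<ge> 2" "n < n0" | "n \<ge> 2" "n \<ge> n0" using n by linarith
    then show ?thesis
    proof cases
      case 1
      then have "k \<ge> 1" using k by simp
      \<comment> \<open>For \<open>n = 1\<close> the logarithm vanishes and the quotient is 0 by the
        convention on division by zero, so nonnegative regret suffices.\<close>
      then have "ereal 0 \<le> regret n k (MGT n k y0)"
        by (intro regret_ge[of "unif k" k 0 n _ 0])
          (auto simp: oracle_risk_unif_full unif_in_prob_simplex)
      then show ?thesis using 1 by simp
    next
      case 2
      have "1 < sqrt (real n)" using 2 by simp
      then have k2: "k \<ge> 2" using k by linarith
      have "real k \<le> real n0 powr C" using k 2 assms powr_mono2[of C "real n" "real n0"] by linarith
      then have "k \<le> nat \<lfloor>real n0 powr C\<rfloor>" by (simp add: le_nat_floor)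
      then have "(n, k) \<in> F" using 2 k2 by (simp add: F_def)
      then have cle: "c \<le> v (n, k)" by (rule cv)
      have "ln 2 \<le> ln (real n)" using 2 by simp
      then have "2 / 3 \<le> ln (real n)" using ln2_ge_two_thirds by linarith
      then have "2 * (2 / 3) \<le> real n * ln (real n)"
        using 2 by (intro mult_mono) auto
      then have "1 \<le> sqrt (real n * ln (real n))" by simp
      then have "c / sqrt (real n * ln (real n)) \<le> c / 1" using c0 by (intro divide_left_mono) auto
      then have "ereal (c / sqrt (real n * ln (real n))) \<le> ereal (v (n, k))" using cle by simp
      also have "\<dots> \<le> regret n k (MGT n k y0)"
        unfolding v_def prod.case using n k2 by (rule regret_MGT_ge_small)
      finally show ?thesis .
    next
      case 3
      have s: "sqrt (real n) \<ge> 10000" using n0 3 by blast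
      then have "10000\<^sup>2 \<le> (sqrt (real n))\<^sup>2" by (intro power_mono) auto
      then have n3: "real n \<ge> 3" by simp
      \<comment> \<open>Once \<open>ln (real n) \<ge> 1\<close>, a bound of order
        \<open>1 / sqrt (real n)\<close> implies the claimed one.\<close>
      have "exp 1 \<le> real n" using n3 e_less_272 by (simp add: power2_eq_square)
      then have "1 \<le> ln (real n)" using n3 by (subst ln_ge_iff) auto
      then have "sqrt (real n) * 1 \<le> sqrt (real n) * sqrt (ln (real n))" by (intro mult_left_mono) auto
      then have "sqrt (real n) \<le> sqrt (real n * ln (real n))" by (simp add: real_sqrt_mult)
      then have "c / sqrt (real n * ln (real n)) \<le> c1 / sqrt (real n)"
        using c0 cc1 s n3 by (intro frac_le) auto
      also have "\<dots> \<le> exp (- 16) / 10 ^ 6 / sqrt (real n) / 2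
          - (1 / real n + exp (- sqrt (real n)) * ((C + 1) * ln (real n)))"
        using n0(1)[of n] 3 by (simp add: c1_def)
      finally show ?thesis using s k by (intro regret_MGT_ge_large)
    qed
  qed
  then show ?thesis using c0 by blast
qed

end
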